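(* Let $k\ge 2$ and $1\le j\le k-1$ be integers and let $s\ge 0$ be an integer. Suppose $p=\frac{j\log n+s\log\log n +c_n}{\binom{n}{k-j}}$ for some real function $c_n=o(\log n)$, and let $D_s$ denote the number of $j$-sets of degree $s$ in $\mathcal{H}^k(n,p)$. Then, as $n\to\infty$: (i) if $c_n\rightarrow \infty$, then $D_s=0$ with probability tending to $1$; (ii) if $c_n\rightarrow c\in\mathbb{R}$, then $D_s$ converges in distribution to a Poisson random variable with mean $\frac{j^s e^{-c}}{j!\,s!}$; (iii) if $c_n \to -\infty$, then $D_s\to \infty$ with probability tending to $1$.
   Context: $\mathcal{H}^k(n,p)$ denotes the binomial random $k$-uniform hypergraph on vertex set $[n]=\{1,\dots,n\}$ in which each $k$-set is an edge independently with probability $p$. A $j$-set is a set of $j$ distinct vertices; its degree is the number of edges containing it. Integer-valued random variables $X_n$ converge in distribution to $Y$ if $\Pr(X_n=i)\to\Pr(Y=i)$ for every integer $i$. "$D_s\to\infty$ with probability tending to $1$" means that for every fixed $K$, $\Pr(D_s\ge K)\to 1$. *)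

theory Defs
  imports
    "HOL-Probability.Probability"
    "HOL-Library.Ramsey"
    "HOL-Library.Landau_Symbols"
begin

text \<open>
  A hypergraph on the vertex set \<open>{1..n}\<close> is represented by its set of edges.
  Outside \<open>0 \<le> p \<le> 1\<close> the library's \<^const>\<open>bernoulli_pmf\<close> clamps \<open>p\<close> to that interval.
\<close>

definition random_hypergraph :: "nat \<Rightarrow> nat \<Rightarrow> real \<Rightarrow> nat set set pmf" where
  "random_hypergraph k n p =
     map_pmf (\<lambda>f. {e \<in> nsets {1..n} k. f e})
       (Pi_pmf (nsets {1..n} k) False (\<lambda>_. bernoulli_pmf p))"

definition set_degree :: "'a set set \<Rightarrow> 'a set \<Rightarrow> nat" where
  "set_degree E J = card {e \<in> E. J \<subseteq> e}"

definition num_sets_of_degree :: "nat \<Rightarrow> nat \<Rightarrow> nat \<Rightarrow> nat set set \<Rightarrow> nat" where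
  "num_sets_of_degree n j s E = card {J \<in> nsets {1..n} j. set_degree E J = s}"

definition converges_in_distribution :: "(nat \<Rightarrow> int pmf) \<Rightarrow> int pmf \<Rightarrow> bool" where
  "converges_in_distribution X Y \<longleftrightarrow> (\<forall>i. (\<lambda>n. pmf (X n) i) \<longlonglongrightarrow> pmf Y i)"

end

theory Submission
  imports Defs
begin

text \<open>
  Write \<open>N\<close> for the number of \<open>k\<close>-sets containing a fixed \<open>j\<close>-set and \<open>b\<close> for the
  probability that a binomial variable with parameters \<open>N\<close> and \<open>p\<close> equals \<open>s\<close>. Fix \<open>r\<close>
  distinct \<open>j\<close>-sets. The edges containing at least two of them number \<open>O(N/n)\<close>, so with
  probability tending to 1 none of them is present; the remaining edges containing one of the
  \<open>j\<close>-sets form \<open>r\<close> disjoint classes, so the degrees are then independent. Hence all \<open>r\<close> sets have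
  degree \<open>s\<close> with probability \<open>(1 + o(1)) b\<^sup>r\<close>, uniformly in the choice of the sets, and the
  factorial moments satisfy \<open>E (D\<^sub>s choose r) = (1 + o(1)) \<mu>\<^sup>r / r!\<close> with
  \<open>\<mu> = (n choose j) b\<close>. Moreover \<open>\<mu> exp(c\<^sub>n)\<close> tends to \<open>j\<^sup>s / (j! s!)\<close>. The three regimes
  follow from Markov's inequality, from Bonferroni's inequalities and from Chebyshev's inequality.
\<close>

subsection \<open>Independence in product distributions\<close>

lemma prob_pair_pmf_Times:
  "measure_pmf.prob (pair_pmf M N) (A \<times> B) = measure_pmf.prob M A * measure_pmf.prob N B"
proof -
  \<comment> \<open>Supports of pmfs are countable, which the product rule
    \<open>measure_pmf_prob_product\<close> demands of both factors.\<close>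
  have "measure_pmf.prob (pair_pmf M N) (A \<times> B) =
        measure_pmf.prob (pair_pmf M N) ((A \<inter> set_pmf M) \<times> (B \<inter> set_pmf N))"
    by (rule measure_pmf.finite_measure_eq_AE) (auto simp: AE_measure_pmf_iff)
  also have "\<dots> = measure_pmf.prob M (A \<inter> set_pmf M) * measure_pmf.prob N (B \<inter> set_pmf N)"
    by (rule measure_pmf_prob_product) auto
  finally show ?thesis
    by (simp add: measure_Int_set_pmf)
qed

text \<open>A pointwise form of measurability with respect to the coordinates in \<open>A\<close>.
  Independence can then be read off from a splitting of the product, without sigma-algebras.\<close>

definition determined_by :: "'a set \<Rightarrow> (('a \<Rightarrow> 'b) \<Rightarrow> bool) \<Rightarrow> bool" where
  "determined_by A P \<longleftrightarrow> (\<forall>f g. (\<forall>x\<in>A. f x = g x) \<longrightarrow> P f = P g)"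

lemma determined_byD: "determined_by A P \<Longrightarrow> (\<And>x. x \<in> A \<Longrightarrow> f x = g x) \<Longrightarrow> P f = P g"
  by (auto simp: determined_by_def)

text \<open>Splitting \<open>S\<close> into \<open>A\<close> and \<open>S - A\<close> turns a random
  function into an independent pair. \<open>P\<close> sees only the first component;
  \<open>Q\<close> sees only the second, because \<open>B\<close> avoids \<open>A\<close>.\<close>

lemma prob_Pi_pmf_indep:
  assumes "finite S" "A \<subseteq> S" "A \<inter> B = {}" and P: "determined_by A P" and Q: "determined_by B Q"
  shows "measure_pmf.prob (Pi_pmf S d p) {f. P f \<and> Q f} =
         measure_pmf.prob (Pi_pmf S d p) {f. P f} * measure_pmf.prob (Pi_pmf S d p) {f. Q f}"
proof -
  define M N where "M = Pi_pmf A d p" and "N = Pi_pmf (S - A) d p"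
  have "finite A" using assms finite_subset by blast
  have S: "Pi_pmf S d p = map_pmf (\<lambda>(f, g) x. if x \<in> A then f x else g x) (pair_pmf M N)"
    using Pi_pmf_union[of A "S - A" d p] \<open>finite A\<close> assms
    by (simp add: M_def N_def Un_absorb1)
  have P': "P (\<lambda>x. if x \<in> A then f x else g x) = P f" for f g
    by (rule determined_byD[OF P]) auto
  have Q': "Q (\<lambda>x. if x \<in> A then f x else g x) = Q g" for f g
    by (rule determined_byD[OF Q]) (use assms in auto)
  \<comment> \<open>Used three times: for the conjunction, and for each event alone with the trivial
    event as the other factor.\<close>
  have eq: "measure_pmf.prob (Pi_pmf S d p) {f. U f} =
            measure_pmf.prob M {f. V f} * measure_pmf.prob N {g. W g}"
    if "\<And>f g. U (\<lambda>x. if x \<in> A then f x else g x) = (V f \<and> W g)" for U V W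
  proof -
    have "(\<lambda>(f, g) x. if x \<in> A then f x else g x) -` {f. U f} = {f. V f} \<times> {g. W g}"
      by (auto simp: that)
    then show ?thesis
      unfolding S measure_map_pmf by (simp only: prob_pair_pmf_Times)
  qed
  show ?thesis
    using eq[of "\<lambda>f. P f \<and> Q f" P Q] eq[of P P "\<lambda>_. True"] eq[of Q "\<lambda>_. True" Q]
    by (simp add: P' Q')
qed

lemma prob_Pi_pmf_indep_family:
  assumes "finite S" "finite I" "\<And>i. i \<in> I \<Longrightarrow> A i \<subseteq> S" "disjoint_family_on A I"
    and "\<And>i. i \<in> I \<Longrightarrow> determined_by (A i) (P i)"
  shows "measure_pmf.prob (Pi_pmf S d p) {f. \<forall>i\<in>I. P i f} =
         (\<Prod>i\<in>I. measure_pmf.prob (Pi_pmf S d p) {f. P i f})"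
  using assms(2-)
proof (induction I rule: finite_induct)
  case empty
  then show ?case by simp
next
  case (insert i I)
  have "measure_pmf.prob (Pi_pmf S d p) {f. \<forall>i\<in>insert i I. P i f} =
        measure_pmf.prob (Pi_pmf S d p) {f. P i f \<and> (\<forall>i\<in>I. P i f)}"
    by simp
  also have "\<dots> = measure_pmf.prob (Pi_pmf S d p) {f. P i f} *
                  measure_pmf.prob (Pi_pmf S d p) {f. \<forall>i\<in>I. P i f}"
  proof (rule prob_Pi_pmf_indep[where A = "A i" and B = "\<Union>i\<in>I. A i"])
    show "A i \<inter> (\<Union>i\<in>I. A i) = {}"
      using insert.prems(2) insert.hyps by (auto simp: disjoint_family_on_def)
    show "determined_by (\<Union>i\<in>I. A i) (\<lambda>f. \<forall>i\<in>I. P i f)"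
      using insert.prems(3) unfolding determined_by_def by (smt (verit) UN_I insertCI)
  qed (use insert assms in auto)
  also have "measure_pmf.prob (Pi_pmf S d p) {f. \<forall>i\<in>I. P i f} =
             (\<Prod>i\<in>I. measure_pmf.prob (Pi_pmf S d p) {f. P i f})"
    by (rule insert.IH) (use insert.prems in \<open>auto simp: disjoint_family_on_def\<close>)
  finally show ?case using insert.hyps by simp
qed

lemma determined_by_card: "determined_by A (\<lambda>f. P (card {x \<in> A. f x}))"
  unfolding determined_by_def
proof (intro allI impI)
  fix f g :: "'a \<Rightarrow> bool" assume "\<forall>x\<in>A. f x = g x"
  then have "{x \<in> A. f x} = {x \<in> A. g x}" by auto
  then show "P (card {x \<in> A. f x}) = P (card {x \<in> A. g x})" by simp
qed

lemma prob_Pi_pmf_card: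
  assumes "finite S" "A \<subseteq> S" "q \<in> {0..1}"
  shows "measure_pmf.prob (Pi_pmf S False (\<lambda>_. bernoulli_pmf q)) {f. P (card {x \<in> A. f x})} =
         measure_pmf.prob (binomial_pmf (card A) q) {m. P m}"
proof -
  have fin: "finite A" using assms finite_subset by blast
  have "binomial_pmf (card A) q =
        map_pmf (\<lambda>f. card {x \<in> A. f x}) (Pi_pmf A False (\<lambda>_. bernoulli_pmf q))"
    by (rule binomial_pmf_altdef') (use fin assms in auto)
  also have "\<dots> = map_pmf (\<lambda>f. card {x \<in> A. f x}) (Pi_pmf S False (\<lambda>_. bernoulli_pmf q))"
    unfolding Pi_pmf_subset[OF assms(1,2)] map_pmf_comp
    by (intro map_pmf_cong refl arg_cong[where f = card]) auto
  finally show ?thesis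
    by (simp add: measure_map_pmf vimage_def)
qed

subsection \<open>Binomial probabilities\<close>

text \<open>Dropping at most \<open>t\<close> trials does not increase the binomial coefficient and
  removes at most \<open>t\<close> factors \<open>1 - q\<close>. It is applied to the edges
  containing a \<open>j\<close>-set that are left after discarding the shared ones, meaning those
  that contain at least two of the fixed \<open>j\<close>-sets.\<close>

lemma pmf_binomial_le_smaller:
  assumes "0 \<le> q" "q < 1" "N - t \<le> N'" "N' \<le> N"
  shows "pmf (binomial_pmf N' q) m \<le> pmf (binomial_pmf N q) m / (1 - q) ^ t"
proof (cases "m \<le> N'")
  case True
  have "real (N' choose m) * q ^ m * ((1 - q) ^ (N' - m) * (1 - q) ^ t)
        \<le> real (N choose m) * q ^ m * (1 - q) ^ (N - m)"
  proof (rule mult_mono)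
    show "real (N' choose m) * q ^ m \<le> real (N choose m) * q ^ m"
      using assms by (intro mult_right_mono) (auto intro: binomial_right_mono)
    show "(1 - q) ^ (N' - m) * (1 - q) ^ t \<le> (1 - q) ^ (N - m)"
      unfolding power_add[symmetric] using assms True by (intro power_decreasing) auto
  qed (use assms in auto)
  then show ?thesis
    using assms by (simp add: field_simps)
next
  case False
  then show ?thesis using assms by (simp add: binomial_eq_0)
qed

text \<open>Fewer trials mean fewer failure factors, so only the binomial coefficient can shrink, at
  worst to that of \<open>N - t\<close>.\<close>

lemma pmf_binomial_ge_smaller:
  assumes "0 \<le> q" "q \<le> 1" "N - t \<le> N'" "N' \<le> N"
  shows "real ((N - t) choose m) / real (N choose m) * pmf (binomial_pmf N q) m
           \<le> pmf (binomial_pmf N' q) m"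
proof (cases "m \<le> N")
  case True
  have "real ((N - t) choose m) * q ^ m * (1 - q) ^ (N - m)
          \<le> real (N' choose m) * q ^ m * (1 - q) ^ (N' - m)"
    using assms
    by (intro mult_mono power_decreasing) (auto intro: binomial_right_mono)
  moreover have "real (N choose m) \<noteq> 0" using True by simp
  ultimately show ?thesis
    using assms by simp
next
  case False
  then show ?thesis using assms by simp
qed

text \<open>The quotient of the probabilities at \<open>m + 1\<close> and \<open>m\<close> is
  \<open>(N - m) q / ((m + 1) (1 - q))\<close>. For \<open>m < s\<close> one has
  \<open>m + 1 \<le> s \<le> (N - s) q \<le> (N - m) q\<close>, so it is at least 1.\<close>

lemma pmf_binomial_mono_below_mean:
  assumes "0 \<le> q" "q \<le> 1" "m \<le> s" "real s \<le> real (N - s) * q"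
  shows "pmf (binomial_pmf N q) m \<le> pmf (binomial_pmf N q) s"
  using assms(3)
proof (induction rule: inc_induct)
  case (step m)
  \<comment> \<open>Otherwise \<open>N - s\<close> is 0 and the hypothesis forces
    \<open>s = 0\<close>, leaving no \<open>m < s\<close>.\<close>
  have "s < N"
    using assms(4) step.hyps by (cases "s < N") auto
  then have mN: "m < N" using step.hyps by simp
  have "real (N choose m) * (Suc m) \<le> real (N choose m) * (real (N - m) * q)"
  proof (rule mult_left_mono)
    have "real (Suc m) \<le> real s" using step.hyps by simp
    also have "\<dots> \<le> real (N - s) * q" by fact
    also have "\<dots> \<le> real (N - m) * q" using step.hyps assms by (intro mult_right_mono) auto
    finally show "real (Suc m) \<le> real (N - m) * q" .
  qed auto
  also have "\<dots> = real (N choose Suc m) * q * Suc m"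
  proof -
    have "Suc m * (N choose Suc m) = (N - m) * (N choose m)"
      using binomial_absorb_comp[of N m] binomial_absorption[of m N] by simp
    then have "real (Suc m) * real (N choose Suc m) = real (N - m) * real (N choose m)"
      by (metis of_nat_mult)
    then show ?thesis by (simp add: algebra_simps)
  qed
  finally have *: "real (N choose m) \<le> real (N choose Suc m) * q"
    by (simp only: mult_le_cancel_right)
  have "pmf (binomial_pmf N q) m = real (N choose m) * q ^ m * (1 - q) ^ (N - m)"
    using assms by simp
  also have "\<dots> \<le> real (N choose m) * q ^ m * (1 - q) ^ (N - Suc m)"
    using assms by (intro mult_left_mono power_decreasing) auto
  also have "\<dots> \<le> (real (N choose Suc m) * q) * q ^ m * (1 - q) ^ (N - Suc m)"
    using assms by (intro mult_right_mono *) auto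
  also have "\<dots> = pmf (binomial_pmf N q) (Suc m)"
    using assms by simp
  finally show ?case using step.IH by simp
qed simp

text \<open>Each of the \<open>s + 1\<close> point probabilities is at most the one at
  \<open>s\<close>, up to the cost of the missing trials. Hence knowing only that a degree is at
  most \<open>s\<close>, rather than equal to \<open>s\<close>, costs a bounded factor.\<close>

lemma prob_binomial_atMost_le:
  assumes "0 \<le> q" "q < 1" "N - t \<le> N'" "N' \<le> N" "real s \<le> real (N - s) * q"
  shows "measure_pmf.prob (binomial_pmf N' q) {..s}
           \<le> real (Suc s) * (pmf (binomial_pmf N q) s / (1 - q) ^ t)"
proof -
  have "measure_pmf.prob (binomial_pmf N' q) {..s} = (\<Sum>m\<le>s. pmf (binomial_pmf N' q) m)"
    by (simp add: measure_measure_pmf_finite)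
  also have "\<dots> \<le> (\<Sum>m\<le>s. pmf (binomial_pmf N q) s / (1 - q) ^ t)"
  proof (rule sum_mono)
    fix m assume "m \<in> {..s}"
    have "pmf (binomial_pmf N' q) m \<le> pmf (binomial_pmf N q) m / (1 - q) ^ t"
      by (rule pmf_binomial_le_smaller) (use assms in auto)
    also have "\<dots> \<le> pmf (binomial_pmf N q) s / (1 - q) ^ t"
      using assms \<open>m \<in> {..s}\<close>
      by (intro divide_right_mono pmf_binomial_mono_below_mean) (auto simp del: of_nat_diff)
    finally show "pmf (binomial_pmf N' q) m \<le> pmf (binomial_pmf N q) s / (1 - q) ^ t" .
  qed
  finally show ?thesis by simp
qed

subsection \<open>Joint degrees of several sets\<close>

lemma card_nsets_containing:
  assumes "finite V" "U \<subseteq> V" "card U \<le> k"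
  shows "card {e \<in> nsets V k. U \<subseteq> e} = (card V - card U) choose (k - card U)"
proof -
  have fU: "finite U" using assms finite_subset by blast
  have "bij_betw (\<lambda>e. e - U) {e \<in> nsets V k. U \<subseteq> e} (nsets (V - U) (k - card U))"
  proof (rule bij_betwI[where g = "\<lambda>e. e \<union> U"])
    show "(\<lambda>e. e - U) \<in> {e \<in> nsets V k. U \<subseteq> e} \<rightarrow> nsets (V - U) (k - card U)"
      using fU by (auto simp: nsets_def card_Diff_subset)
    show "(\<lambda>e. e \<union> U) \<in> nsets (V - U) (k - card U) \<rightarrow> {e \<in> nsets V k. U \<subseteq> e}"
    proof
      fix e assume e: "e \<in> nsets (V - U) (k - card U)"
      then have "card (e \<union> U) = k"
        using fU assms by (subst card_Un_disjoint) (auto simp: nsets_def)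
      then show "e \<union> U \<in> {e \<in> nsets V k. U \<subseteq> e}"
        using e assms fU by (auto simp: nsets_def)
    qed
  qed (auto simp: nsets_def)
  then have "card {e \<in> nsets V k. U \<subseteq> e} = card (nsets (V - U) (k - card U))"
    by (rule bij_betw_same_card)
  then show ?thesis using assms fU by (simp add: card_Diff_subset)
qed

text \<open>Two distinct sets of the same size are incomparable, so an edge containing both contains
  \<open>J\<close> and a further vertex \<open>v\<close>. This fixes \<open>j + 1\<close> vertices
  for each of at most \<open>r\<^sup>2\<close> ordered pairs.\<close>

lemma card_nsets_containing_two:
  assumes "R \<in> nsets (nsets {1..n} j) r" "j < k"
  shows "card {e \<in> nsets {1..n} k. \<exists>J\<in>R. \<exists>J'\<in>R. J \<noteq> J' \<and> J \<subseteq> e \<and> J' \<subseteq> e}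
           \<le> r\<^sup>2 * ((n - 1) choose (k - j - 1))"
proof -
  have R: "finite R" "card R = r" "\<And>J. J \<in> R \<Longrightarrow> J \<subseteq> {1..n} \<and> finite J \<and> card J = j"
    using assms by (auto simp: nsets_def)
  define F where "F = (\<lambda>(J, J'). {e \<in> nsets {1..n} k. J \<union> J' \<subseteq> e})"
  define P where "P = {(J, J') \<in> R \<times> R. J \<noteq> J'}"
  have "finite P" by (rule finite_subset[of _ "R \<times> R"]) (auto simp: P_def R)
  have cardP: "card P \<le> r\<^sup>2"
    using card_mono[of "R \<times> R" P] R by (auto simp: P_def card_cartesian_product power2_eq_square)
  have F: "card (F x) \<le> (n - 1) choose (k - j - 1)" if "x \<in> P" for x
  proof -
    obtain J J' where x: "x = (J, J')" "J \<in> R" "J' \<in> R" "J \<noteq> J'"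
      using \<open>x \<in> P\<close> by (auto simp: P_def)
    then have "\<not> J' \<subseteq> J" using R card_subset_eq[of J J'] by force
    then obtain v where v: "v \<in> J'" "v \<notin> J" by auto
    have "F x \<subseteq> {e \<in> nsets {1..n} k. insert v J \<subseteq> e}"
      using v by (auto simp: F_def x)
    then have "card (F x) \<le> card {e \<in> nsets {1..n} k. insert v J \<subseteq> e}"
      by (intro card_mono) (auto intro: finite_subset[OF _ finite_imp_finite_nsets])
    also have "\<dots> = (card {1..n} - card (insert v J)) choose (k - card (insert v J))"
      by (rule card_nsets_containing) (use v x R(3)[of J] R(3)[of J'] assms in auto)
    \<comment> \<open>The exact upper index is \<open>n - j - 1\<close>. Raising it to
      \<open>n - 1\<close> makes the absorption identity \<open>choose_absorb\<close> applicable
      later.\<close>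
    also have "\<dots> \<le> (n - 1) choose (k - j - 1)"
      using v x R by (auto intro!: binomial_right_mono)
    finally show ?thesis .
  qed
  have "{e \<in> nsets {1..n} k. \<exists>J\<in>R. \<exists>J'\<in>R. J \<noteq> J' \<and> J \<subseteq> e \<and> J' \<subseteq> e} = (\<Union>x\<in>P. F x)"
    by (auto simp: F_def P_def)
  also have "card \<dots> \<le> (\<Sum>x\<in>P. card (F x))"
    by (rule card_UN_le) fact
  also have "\<dots> \<le> card P * ((n - 1) choose (k - j - 1))"
    using sum_bounded_above[of P "\<lambda>x. card (F x)"] F by simp
  also have "\<dots> \<le> r\<^sup>2 * ((n - 1) choose (k - j - 1))"
    using cardP by (rule mult_right_mono) simp
  finally show ?thesis .
qed

lemma prob_all_degree_bounds:
  fixes q :: real and s :: nat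
  assumes q: "0 \<le> q" "q < 1" and jk: "j < k" and R: "R \<in> nsets (nsets {1..n} j) r"
  defines "N \<equiv> (n - j) choose (k - j)" and "t \<equiv> r\<^sup>2 * ((n - 1) choose (k - j - 1))"
  defines "b \<equiv> pmf (binomial_pmf N q) s"
  defines "G \<equiv> measure_pmf.prob (random_hypergraph k n q) {E. \<forall>J\<in>R. set_degree E J = s}"
  shows "(1 - q) ^ t * (real ((N - t) choose s) / real (N choose s)) ^ r * b ^ r \<le> G"
    and "real s \<le> real (N - s) * q \<Longrightarrow>
         G \<le> (1 + (1 - (1 - q) ^ t) * real (Suc s) ^ r) / ((1 - q) ^ t) ^ r * b ^ r"
proof -
  define S where "S = nsets {1..n} k"
  define M where "M = Pi_pmf S False (\<lambda>_. bernoulli_pmf q)"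
  \<comment> \<open>If no edge of \<open>T\<close> is present, the degree of \<open>J\<close> is the number of present edges in \<open>A J\<close>.
    Otherwise degree \<open>s\<close> still forces at most \<open>s\<close> of them, an event independent of \<open>T\<close> whose
    probability is within a constant factor of that of exactly \<open>s\<close>.\<close>
  define T where "T = {e \<in> S. \<exists>J\<in>R. \<exists>J'\<in>R. J \<noteq> J' \<and> J \<subseteq> e \<and> J' \<subseteq> e}"
  define A where "A = (\<lambda>J. {e \<in> S. J \<subseteq> e} - T)"
  have finS: "finite S" by (simp add: S_def finite_imp_finite_nsets)
  have finR: "finite R" "card R = r" "\<And>J. J \<in> R \<Longrightarrow> J \<subseteq> {1..n} \<and> finite J \<and> card J = j"
    using R by (auto simp: nsets_def)
  have TS: "T \<subseteq> S" and AS: "A J \<subseteq> S" for J by (auto simp: T_def A_def)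
  have finT: "finite T" and finA: "finite (A J)" for J
    using finS TS AS finite_subset by blast+
  \<comment> \<open>An edge lying over two different members of \<open>R\<close> belongs to
    \<open>T\<close>, which is removed from every \<open>A J\<close>.\<close>
  have disj: "disjoint_family_on A R"
    by (auto simp: disjoint_family_on_def A_def T_def)
  have cardT: "card T \<le> t"
    unfolding T_def t_def S_def by (rule card_nsets_containing_two) (use R jk in auto)
  have cardA: "N - t \<le> card (A J)" "card (A J) \<le> N" if "J \<in> R" for J
  proof -
    have N: "card {e \<in> S. J \<subseteq> e} = N"
      unfolding S_def N_def using finR(3)[OF that] jk by (subst card_nsets_containing) auto
    have "N - card T \<le> card (A J)"
      unfolding A_def N[symmetric] by (rule diff_card_le_card_Diff) fact
    then show "N - t \<le> card (A J)" using cardT by simp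
    show "card (A J) \<le> N"
      unfolding A_def N[symmetric] using finS by (intro card_mono) auto
  qed
  have deg: "card {e \<in> {e \<in> S. f e}. J \<subseteq> e} =
             card {e \<in> A J. f e} + card {e \<in> {e \<in> T. f e}. J \<subseteq> e}" if "J \<in> R" for f J
  proof -
    have "{e \<in> {e \<in> S. f e}. J \<subseteq> e} = {e \<in> A J. f e} \<union> {e \<in> {e \<in> T. f e}. J \<subseteq> e}"
      using TS by (auto simp: A_def)
    also have "card \<dots> = card {e \<in> A J. f e} + card {e \<in> {e \<in> T. f e}. J \<subseteq> e}"
      using finT finS by (intro card_Un_disjoint) (auto simp: A_def)
    finally show ?thesis .
  qed
  have G: "G = measure_pmf.prob M {f. \<forall>J\<in>R. card {e \<in> {e \<in> S. f e}. J \<subseteq> e} = s}"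
    by (simp add: G_def M_def random_hypergraph_def measure_map_pmf vimage_def set_degree_def S_def)
  have fam: "measure_pmf.prob M {f. \<forall>J\<in>R. Q (card {e \<in> A J. f e})} =
             (\<Prod>J\<in>R. measure_pmf.prob (binomial_pmf (card (A J)) q) {m. Q m})" for Q
    unfolding M_def using finS finR AS disj q
    by (subst prob_Pi_pmf_indep_family[where A = A])
       (auto simp: determined_by_card intro!: prod.cong prob_Pi_pmf_card)
  \<comment> \<open>\<open>T\<close> is disjoint from all \<open>A J\<close>, so its count is
    independent of theirs. Leaving \<open>Q\<close> and \<open>Q'\<close> free lets both bounds use
    the same factorisation.\<close>
  have indep: "measure_pmf.prob M {f. Q' (card {e \<in> T. f e}) \<and> (\<forall>J\<in>R. Q (card {e \<in> A J. f e}))} =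
        measure_pmf.prob (binomial_pmf (card T) q) {m. Q' m} *
        (\<Prod>J\<in>R. measure_pmf.prob (binomial_pmf (card (A J)) q) {m. Q m})" for Q Q'
  proof -
    have "measure_pmf.prob M {f. Q' (card {e \<in> T. f e}) \<and> (\<forall>J\<in>R. Q (card {e \<in> A J. f e}))} =
          measure_pmf.prob M {f. Q' (card {e \<in> T. f e})} *
          measure_pmf.prob M {f. \<forall>J\<in>R. Q (card {e \<in> A J. f e})}"
      unfolding M_def
    proof (rule prob_Pi_pmf_indep[where A = T and B = "\<Union>J\<in>R. A J"])
      show "determined_by (\<Union>J\<in>R. A J) (\<lambda>f. \<forall>J\<in>R. Q (card {e \<in> A J. f e}))"
        unfolding determined_by_def
      proof (intro allI impI ball_cong refl)
        fix f g :: "nat set \<Rightarrow> bool" and J assume "\<forall>x\<in>\<Union>J\<in>R. A J. f x = g x" and "J \<in> R"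
        then show "Q (card {e \<in> A J. f e}) = Q (card {e \<in> A J. g e})"
          by (intro determined_byD[OF determined_by_card]) auto
      qed
    qed (use finS TS in \<open>auto simp: determined_by_card A_def\<close>)
    also have "measure_pmf.prob M {f. Q' (card {e \<in> T. f e})} =
               measure_pmf.prob (binomial_pmf (card T) q) {m. Q' m}"
      unfolding M_def using finS TS q by (intro prob_Pi_pmf_card) auto
    finally show ?thesis by (simp add: fam)
  qed
  have bnn: "0 \<le> b" by (simp add: b_def)
  have pT0: "measure_pmf.prob (binomial_pmf (card T) q) {m. m = 0} = (1 - q) ^ card T"
    using q by (simp add: measure_pmf_single)
  have pT: "(1 - q) ^ t \<le> (1 - q) ^ card T"
    using q cardT by (intro power_decreasing) auto

  \<comment> \<open>Lower bound: \<open>(1 - q) ^ t\<close> pays for the absence of all edges of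
    \<open>T\<close>, and the ratio of binomial coefficients pays for the edges missing from each
    \<open>A J\<close>.\<close>
  have "(1 - q) ^ t * (real ((N - t) choose s) / real (N choose s)) ^ r * b ^ r =
        (1 - q) ^ t * (\<Prod>J\<in>R. real ((N - t) choose s) / real (N choose s) * b)"
    by (simp only: prod_constant finR power_mult_distrib mult.assoc)
  also have "\<dots> \<le> (1 - q) ^ card T * (\<Prod>J\<in>R. pmf (binomial_pmf (card (A J)) q) s)"
    using q cardA bnn unfolding b_def
    by (intro mult_mono pT prod_mono conjI pmf_binomial_ge_smaller prod_nonneg) auto
  also have "\<dots> = measure_pmf.prob M {f. card {e \<in> T. f e} = 0 \<and> (\<forall>J\<in>R. card {e \<in> A J. f e} = s)}"
    using indep[of "\<lambda>m. m = 0" "\<lambda>m. m = s"] pT0 by (simp add: measure_pmf_single)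
  also have "\<dots> \<le> G"
    unfolding G
  proof (rule measure_pmf.finite_measure_mono, safe)
    fix f J assume f: "card {e \<in> T. f e} = 0" "\<forall>J\<in>R. card {e \<in> A J. f e} = s" and "J \<in> R"
    have "{e \<in> T. f e} = {}" using f finT by simp
    then have "card {e \<in> {e \<in> T. f e}. J \<subseteq> e} = card ({} :: nat set set)"
      by (intro arg_cong[where f = card]) blast
    then show "card {e \<in> {e \<in> S. f e}. J \<subseteq> e} = s"
      using deg[OF \<open>J \<in> R\<close>, of f] f \<open>J \<in> R\<close> by simp
  qed auto
  finally show "(1 - q) ^ t * (real ((N - t) choose s) / real (N choose s)) ^ r * b ^ r \<le> G" .

  assume s: "real s \<le> real (N - s) * q"
  \<comment> \<open>\<open>B\<close> bounds the probability that one class \<open>A J\<close>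
    contributes exactly \<open>s\<close> edges. On the event that \<open>T\<close> is hit, each
    factor is at most \<open>Suc s * B\<close> instead.\<close>
  define B where "B = b / (1 - q) ^ t"
  have Bnn: "B \<ge> 0" using bnn q by (simp add: B_def)
  have "G \<le> measure_pmf.prob M ({f. \<forall>J\<in>R. card {e \<in> A J. f e} = s} \<union>
              {f. card {e \<in> T. f e} \<noteq> 0 \<and> (\<forall>J\<in>R. card {e \<in> A J. f e} \<le> s)})"
    unfolding G
  proof (rule measure_pmf.finite_measure_mono, rule subsetI)
    fix f assume "f \<in> {f. \<forall>J\<in>R. card {e \<in> {e \<in> S. f e}. J \<subseteq> e} = s}"
    then have f: "card {e \<in> A J. f e} + card {e \<in> {e \<in> T. f e}. J \<subseteq> e} = s" if "J \<in> R" for J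
      using deg[OF that, of f] that by auto
    show "f \<in> {f. \<forall>J\<in>R. card {e \<in> A J. f e} = s} \<union>
              {f. card {e \<in> T. f e} \<noteq> 0 \<and> (\<forall>J\<in>R. card {e \<in> A J. f e} \<le> s)}"
    proof (cases "card {e \<in> T. f e} = 0")
      case True
      then have "{e \<in> T. f e} = {}" using finT by simp
      then have "card {e \<in> {e \<in> T. f e}. J \<subseteq> e} = card ({} :: nat set set)" for J
        by (intro arg_cong[where f = card]) blast
      then show ?thesis using f by simp
    next
      case False
      have "card {e \<in> A J. f e} \<le> s" if "J \<in> R" for J
        using f[OF that] by linarith
      then show ?thesis using False by blast
    qed
  qed auto
  also have "\<dots> \<le> measure_pmf.prob M {f. \<forall>J\<in>R. card {e \<in> A J. f e} = s} +
      measure_pmf.prob M {f. card {e \<in> T. f e} \<noteq> 0 \<and> (\<forall>J\<in>R. card {e \<in> A J. f e} \<le> s)}"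
    by (rule measure_subadditive) auto
  also have "measure_pmf.prob M {f. \<forall>J\<in>R. card {e \<in> A J. f e} = s} =
             (\<Prod>J\<in>R. pmf (binomial_pmf (card (A J)) q) s)"
    using fam[of "\<lambda>m. m = s"] by (simp add: measure_pmf_single)
  also have "\<dots> \<le> (\<Prod>J\<in>R. B)"
    unfolding B_def b_def using q cardA by (intro prod_mono conjI pmf_binomial_le_smaller) auto
  also have "measure_pmf.prob M {f. card {e \<in> T. f e} \<noteq> 0 \<and> (\<forall>J\<in>R. card {e \<in> A J. f e} \<le> s)} =
      measure_pmf.prob (binomial_pmf (card T) q) {m. m \<noteq> 0} *
      (\<Prod>J\<in>R. measure_pmf.prob (binomial_pmf (card (A J)) q) {..s})"
    using indep[of "\<lambda>m. m \<noteq> 0" "\<lambda>m. m \<le> s"] by (simp add: atMost_def)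
  also have "measure_pmf.prob (binomial_pmf (card T) q) {m. m \<noteq> 0} = 1 - (1 - q) ^ card T"
    using measure_pmf.prob_compl[of "{m. m = 0}" "binomial_pmf (card T) q"] pT0
    by (simp add: Compl_eq_Diff_UNIV[symmetric] Collect_neg_eq[symmetric] del: Collect_const singleton_conv singleton_conv2)
  also have "(1 - (1 - q) ^ card T) * (\<Prod>J\<in>R. measure_pmf.prob (binomial_pmf (card (A J)) q) {..s})
      \<le> (1 - (1 - q) ^ t) * (\<Prod>J\<in>R. real (Suc s) * B)"
    using q cardA s pT power_le_one[of "1 - q"] unfolding B_def b_def
    by (intro mult_mono prod_mono conjI prob_binomial_atMost_le prod_nonneg) (auto simp del: of_nat_diff)
  finally have "G \<le> B ^ r + (1 - (1 - q) ^ t) * (real (Suc s) * B) ^ r"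
    by (simp only: prod_constant finR add_left_mono)
  also have "\<dots> = (1 + (1 - (1 - q) ^ t) * real (Suc s) ^ r) * B ^ r"
    unfolding power_mult_distrib by (simp only: distrib_right mult_1 mult.assoc)
  also have "\<dots> = (1 + (1 - (1 - q) ^ t) * real (Suc s) ^ r) / ((1 - q) ^ t) ^ r * b ^ r"
    by (simp only: B_def power_divide times_divide_eq_left times_divide_eq_right)
  finally show "G \<le> (1 + (1 - (1 - q) ^ t) * real (Suc s) ^ r) / ((1 - q) ^ t) ^ r * b ^ r" .
qed

subsection \<open>Limit laws from factorial moments\<close>

text \<open>For \<open>x \<ge> i\<close> the product of coefficients equals
  \<open>(x choose i) * ((x - i) choose l)\<close>. If \<open>x > i\<close>, the alternating sum
  along row \<open>x - i\<close> up to \<open>m\<close> is plus or minus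
  \<open>(x - i - 1) choose m\<close>, hence no larger than the last term kept. If
  \<open>x < i\<close>, everything vanishes.\<close>

lemma bonferroni_truncation:
  fixes x i m :: nat
  shows "\<bar>of_bool (x = i) - (\<Sum>l\<le>m. (- 1) ^ l * (real ((i + l) choose i) * real (x choose (i + l))))\<bar>
           \<le> real ((i + m) choose i) * real (x choose (i + m))"
proof (cases "i \<le> x")
  case True
  have mult: "real ((i + l) choose i) * real (x choose (i + l)) =
              real (x choose i) * real ((x - i) choose l)" for l
  proof (cases "i + l \<le> x")
    case True
    then have "(x choose (i + l)) * ((i + l) choose i) = (x choose i) * ((x - i) choose l)"
      using choose_mult[of i "i + l" x] by simp
    then show ?thesis by (metis mult.commute of_nat_mult)
  next
    case False
    then show ?thesis using True by (simp add: binomial_eq_0)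
  qed
  have "(\<Sum>l\<le>m. (- 1) ^ l * (real ((i + l) choose i) * real (x choose (i + l)))) =
        real (x choose i) * (\<Sum>l\<le>m. real ((x - i) choose l) * (- 1) ^ l)"
    unfolding mult sum_distrib_left by (intro sum.cong) auto
  also have "(\<Sum>l\<le>m. real ((x - i) choose l) * (- 1) ^ l) =
             of_bool (x = i) + of_bool (x \<noteq> i) * (- 1) ^ m * real ((x - i - 1) choose m)"
  proof (cases "x = i")
    case True
    have "(\<Sum>l\<le>m. real (0 choose l) * (- 1) ^ l) = (\<Sum>l\<in>{0}. real (0 choose l) * (- 1) ^ l)"
      by (rule sum.mono_neutral_right) (auto simp: binomial_eq_0)
    then show ?thesis using True by simp
  next
    case False
    have "(\<Sum>l\<le>m. real ((x - i) choose l) * (- 1) ^ l) =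
          (- 1) ^ m * ((real (x - i) - 1) gchoose m)"
      using gbinomial_sum_lower_neg[of "real (x - i)" m] by (simp add: binomial_gbinomial)
    also have "real (x - i) - 1 = real (x - i - 1)"
      using False True by simp
    finally show ?thesis using False by (simp add: binomial_gbinomial)
  qed
  finally have "\<bar>of_bool (x = i) - (\<Sum>l\<le>m. (- 1) ^ l * (real ((i + l) choose i) * real (x choose (i + l))))\<bar>
      = of_bool (x \<noteq> i) * (real (x choose i) * real ((x - i - 1) choose m))"
    by (auto simp: abs_mult)
  also have "\<dots> \<le> real (x choose i) * real ((x - i) choose m)"
    by (auto intro!: mult_left_mono binomial_right_mono)
  finally show ?thesis unfolding mult .
next
  case False
  then show ?thesis by (simp add: binomial_eq_0)
qed

text \<open>Take expectations in \<open>bonferroni_truncation\<close>, let \<open>n\<close> tend to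
  infinity with the truncation point \<open>m\<close> fixed, and only then let \<open>m\<close>
  grow. The limiting main terms are partial sums of the series of \<open>exp (- \<mu>)\<close>, and
  the limiting error is a multiple of \<open>\<mu> ^ m / fact m\<close>.\<close>

lemma pmf_tendsto_poisson:
  fixes X :: "nat \<Rightarrow> nat pmf" and \<mu> :: real
  assumes fin: "\<And>n. finite (set_pmf (X n))"
    and mom: "\<And>r. (\<lambda>n. measure_pmf.expectation (X n) (\<lambda>x. real (x choose r))) \<longlonglongrightarrow> \<mu> ^ r / fact r"
  shows "(\<lambda>n. pmf (X n) i) \<longlonglongrightarrow> \<mu> ^ i / fact i * exp (- \<mu>)"
proof -
  define F where "F = (\<lambda>r n. measure_pmf.expectation (X n) (\<lambda>x. real (x choose r)))"
  define S where "S = (\<lambda>m n. \<Sum>l\<le>m. (- 1) ^ l * (real ((i + l) choose i) * F (i + l) n))"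
  define L where "L = (\<lambda>m. \<Sum>l\<le>m. (- 1) ^ l * (real ((i + l) choose i) * (\<mu> ^ (i + l) / fact (i + l))))"
  have int: "integrable (measure_pmf (X n)) f" for n and f :: "nat \<Rightarrow> real"
    by (rule integrable_measure_pmf_finite[OF fin])
  have coef: "real ((i + l) choose i) * (\<mu> ^ (i + l) / fact (i + l)) = \<mu> ^ i / fact i * (\<mu> ^ l / fact l)" for l
    by (simp add: binomial_fact power_add field_simps)
  have bound: "\<bar>pmf (X n) i - S m n\<bar> \<le> real ((i + m) choose i) * F (i + m) n" for m n
  proof -
    define h where "h = (\<lambda>l x. (- 1) ^ l * (real ((i + l) choose i) * real (x choose (i + l))))"
    have "pmf (X n) i = measure_pmf.expectation (X n) (indicator {i})"
      by (simp add: measure_pmf_single)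
    also have "indicator {i} = (\<lambda>x. of_bool (x = i) :: real)"
      by (auto simp: fun_eq_iff)
    finally have 1: "pmf (X n) i = measure_pmf.expectation (X n) (\<lambda>x. of_bool (x = i))" .
    have "measure_pmf.expectation (X n) (\<lambda>x. \<Sum>l\<le>m. h l x) =
          (\<Sum>l\<le>m. measure_pmf.expectation (X n) (h l))"
      by (rule Bochner_Integration.integral_sum) (rule int)
    also have "\<dots> = S m n"
      by (simp add: S_def F_def h_def)
    finally have 2: "S m n = measure_pmf.expectation (X n) (\<lambda>x. \<Sum>l\<le>m. h l x)" ..
    have "pmf (X n) i - S m n =
          measure_pmf.expectation (X n) (\<lambda>x. of_bool (x = i) - (\<Sum>l\<le>m. h l x))"
      unfolding 1 2 by (rule Bochner_Integration.integral_diff[symmetric]) (rule int)+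
    also have "\<bar>\<dots>\<bar> \<le> measure_pmf.expectation (X n) (\<lambda>x. \<bar>of_bool (x = i) - (\<Sum>l\<le>m. h l x)\<bar>)"
      by (rule integral_abs_bound)
    also have "\<dots> \<le> measure_pmf.expectation (X n) (\<lambda>x. real ((i + m) choose i) * real (x choose (i + m)))"
      by (rule integral_mono[OF int int]) (unfold h_def, rule bonferroni_truncation)
    also have "\<dots> = real ((i + m) choose i) * F (i + m) n"
      unfolding F_def by (rule integral_mult_right_zero)
    finally show ?thesis .
  qed
  have Flim: "F r \<longlonglongrightarrow> \<mu> ^ r / fact r" for r
    unfolding F_def by (rule mom)
  have SL: "S m \<longlonglongrightarrow> L m" for m
    unfolding S_def L_def by (intro tendsto_intros Flim)
  have "(\<lambda>l. (- \<mu>) ^ l /\<^sub>R fact l) sums exp (- \<mu>)"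
    by (rule exp_converges)
  then have "(\<lambda>m. \<mu> ^ i / fact i * (\<Sum>l\<le>m. (- \<mu>) ^ l /\<^sub>R fact l)) \<longlonglongrightarrow> \<mu> ^ i / fact i * exp (- \<mu>)"
    unfolding sums_def_le by (intro tendsto_intros)
  moreover have "L = (\<lambda>m. \<mu> ^ i / fact i * (\<Sum>l\<le>m. (- \<mu>) ^ l /\<^sub>R fact l))"
    unfolding L_def coef sum_distrib_left
    by (intro ext sum.cong refl) (simp add: power_minus[of \<mu>] divide_inverse mult_ac)
  ultimately have Llim: "L \<longlonglongrightarrow> \<mu> ^ i / fact i * exp (- \<mu>)"
    by (simp only:)
  have "(\<lambda>m. \<mu> ^ m / fact m) \<longlonglongrightarrow> 0"
    using summable_LIMSEQ_zero[OF summable_exp[of \<mu>]] by (simp add: field_simps)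
  then have Elim: "(\<lambda>m. \<mu> ^ i / fact i * (\<mu> ^ m / fact m)) \<longlonglongrightarrow> 0"
    by (rule tendsto_mult_right_zero)
  show ?thesis
  proof (rule LIMSEQ_I)
    fix e :: real assume "e > 0"
    \<comment> \<open>Four errors add up: from \<open>S m n\<close> to \<open>L m\<close>, from
      \<open>L m\<close> to its limit, the limiting truncation error, and the deviation of the
      truncation error from that limit.\<close>
    then have e: "e / 4 > 0" by simp
    obtain m1 where m1: "\<And>m. m \<ge> m1 \<Longrightarrow> norm (L m - \<mu> ^ i / fact i * exp (- \<mu>)) < e / 4"
      using LIMSEQ_D[OF Llim e] by blast
    obtain m2 where m2: "\<And>m. m \<ge> m2 \<Longrightarrow> norm (\<mu> ^ i / fact i * (\<mu> ^ m / fact m) - 0) < e / 4"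
      using LIMSEQ_D[OF Elim e] by blast
    define m where "m = max m1 m2"
    have m: "norm (L m - \<mu> ^ i / fact i * exp (- \<mu>)) < e / 4"
       "norm (\<mu> ^ i / fact i * (\<mu> ^ m / fact m) - 0) < e / 4"
      using m1[of m] m2[of m] by (auto simp: m_def)
    have "(\<lambda>n. real ((i + m) choose i) * F (i + m) n) \<longlonglongrightarrow> \<mu> ^ i / fact i * (\<mu> ^ m / fact m)"
      unfolding coef[symmetric] by (intro tendsto_intros Flim)
    from LIMSEQ_D[OF this e] obtain n1 where n1:
      "\<And>n. n \<ge> n1 \<Longrightarrow> norm (real ((i + m) choose i) * F (i + m) n - \<mu> ^ i / fact i * (\<mu> ^ m / fact m)) < e / 4"
      by blast
    from LIMSEQ_D[OF SL e] obtain n2 where n2: "\<And>n. n \<ge> n2 \<Longrightarrow> norm (S m n - L m) < e / 4"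
      by blast
    show "\<exists>n0. \<forall>n\<ge>n0. norm (pmf (X n) i - \<mu> ^ i / fact i * exp (- \<mu>)) < e"
    proof (intro exI allI impI)
      fix n assume n: "n \<ge> max n1 n2"
      show "norm (pmf (X n) i - \<mu> ^ i / fact i * exp (- \<mu>)) < e"
        using bound[of n m] n1[of n] n2[of n] n m unfolding real_norm_def by linarith
    qed
  qed
qed

section \<open>First and second moment methods\<close>

lemma squeeze_le_1:
  fixes f g :: "nat \<Rightarrow> real"
  assumes "\<And>n. f n \<le> g n" "f \<longlonglongrightarrow> 1" "\<And>n. g n \<le> 1"
  shows "g \<longlonglongrightarrow> 1"
  by (rule tendsto_sandwich[OF _ _ assms(2) tendsto_const]) (use assms in auto)

lemma prob_zero_tendsto_1:
  fixes X :: "nat \<Rightarrow> nat pmf"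
  assumes fin: "\<And>n. finite (set_pmf (X n))"
    and mean: "(\<lambda>n. measure_pmf.expectation (X n) real) \<longlonglongrightarrow> 0"
  shows "(\<lambda>n. measure_pmf.prob (X n) {0}) \<longlonglongrightarrow> 1"
proof -
  have "1 - measure_pmf.expectation (X n) real \<le> measure_pmf.prob (X n) {0}" for n
  proof -
    have int: "integrable (measure_pmf (X n)) f" for f :: "nat \<Rightarrow> real"
      by (rule integrable_measure_pmf_finite[OF fin])
    have "1 - measure_pmf.expectation (X n) real = measure_pmf.expectation (X n) (\<lambda>x. 1 - real x)"
      by (subst Bochner_Integration.integral_diff[OF int int]) simp
    \<comment> \<open>Markov's inequality in pointwise form: \<open>1 - x\<close> is 1 at 0 and
      nonpositive at every positive integer.\<close>
    also have "\<dots> \<le> measure_pmf.expectation (X n) (indicator {0})"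
      by (rule integral_mono[OF int int]) (simp add: indicator_def)
    finally show ?thesis by simp
  qed
  moreover have "(\<lambda>n. 1 - measure_pmf.expectation (X n) real) \<longlonglongrightarrow> 1"
    using tendsto_diff[OF tendsto_const mean, of 1] by simp
  ultimately show ?thesis
    using measure_pmf.prob_le_1 by (rule squeeze_le_1)
qed

text \<open>Since \<open>x\<^sup>2 = 2 * (x choose 2) + x\<close>, the hypotheses make the variance
  negligible against the squared mean. Once the mean is at least \<open>2 * K\<close>, a value below
  \<open>K\<close> deviates from it by at least half the mean; Chebyshev at that distance yields the
  factor 4.\<close>

lemma second_moment_prob_ge_tendsto_1:
  fixes X :: "nat \<Rightarrow> nat pmf"
  assumes fin: "\<And>n. finite (set_pmf (X n))"
    and m1: "filterlim (\<lambda>n. measure_pmf.expectation (X n) real) at_top sequentially"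
    and m2: "(\<lambda>n. measure_pmf.expectation (X n) (\<lambda>x. real (x choose 2)) /
                  (measure_pmf.expectation (X n) real)\<^sup>2) \<longlonglongrightarrow> 1 / 2"
  shows "(\<lambda>n. measure_pmf.prob (X n) {K..}) \<longlonglongrightarrow> 1"
proof -
  define a where "a = (\<lambda>n. measure_pmf.expectation (X n) real)"
  define d where "d = (\<lambda>n. measure_pmf.expectation (X n) (\<lambda>x. real (x choose 2)))"
  have int: "integrable (measure_pmf (X n)) f" for n and f :: "nat \<Rightarrow> real"
    by (rule integrable_measure_pmf_finite[OF fin])
  have bound: "1 - 4 * (2 * (d n / (a n)\<^sup>2) + inverse (a n) - 1) \<le> measure_pmf.prob (X n) {K..}"
    if "a n > 0" "a n \<ge> 2 * real K" for n
  proof -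
    have sq: "(real x)\<^sup>2 = 2 * real (x choose 2) + real x" for x
    proof -
      have "2 * (x choose 2) = x * (x - 1)"
        unfolding choose_two by (cases "even x") (simp_all add: dvd_mult_div_cancel)
      then have "2 * real (x choose 2) = real x * real (x - 1)"
        by (metis of_nat_mult of_nat_numeral)
      then show ?thesis by (cases x) (auto simp: power2_eq_square algebra_simps)
    qed
    have "measure_pmf.variance (X n) real = measure_pmf.expectation (X n) (\<lambda>x. (real x)\<^sup>2) - (a n)\<^sup>2"
      unfolding a_def by (rule measure_pmf.variance_eq) (rule int)+
    also have "measure_pmf.expectation (X n) (\<lambda>x. (real x)\<^sup>2) = 2 * d n + a n"
      unfolding sq a_def d_def by (subst Bochner_Integration.integral_add[OF int int]) simp
    finally have var: "measure_pmf.variance (X n) real = 2 * d n + a n - (a n)\<^sup>2" .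
    have "1 - measure_pmf.prob (X n) {K..} = measure_pmf.prob (X n) (UNIV - {K..})"
      using measure_pmf.prob_compl[of "{K..}" "X n"] by simp
    also have "\<dots> \<le> measure_pmf.prob (X n) {x \<in> space (measure_pmf (X n)). a n / 2 \<le> \<bar>real x - a n\<bar>}"
      using that by (intro measure_pmf.finite_measure_mono) auto
    also have "\<dots> \<le> measure_pmf.variance (X n) real / (a n / 2)\<^sup>2"
      unfolding a_def using that by (intro measure_pmf.Chebyshev_inequality int) (auto simp: a_def)
    also have "\<dots> = 4 * (2 * (d n / (a n)\<^sup>2) + inverse (a n) - 1)"
      unfolding var using that by (simp add: field_simps power2_eq_square)
    finally show ?thesis by linarith
  qed
  have a: "filterlim a at_top sequentially" using m1 by (simp add: a_def)
  have "(\<lambda>n. inverse (a n)) \<longlonglongrightarrow> 0"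
    using a by (rule tendsto_inverse_0_at_top)
  moreover have "(\<lambda>n. d n / (a n)\<^sup>2) \<longlonglongrightarrow> 1 / 2" using m2 by (simp add: a_def d_def)
  ultimately have "(\<lambda>n. 1 - 4 * (2 * (d n / (a n)\<^sup>2) + inverse (a n) - 1)) \<longlonglongrightarrow> 1 - 4 * (2 * (1 / 2) + 0 - 1)"
    by (intro tendsto_diff tendsto_add tendsto_mult_left tendsto_const)
  then have lim: "(\<lambda>n. 1 - 4 * (2 * (d n / (a n)\<^sup>2) + inverse (a n) - 1)) \<longlonglongrightarrow> 1" by simp
  have "\<forall>\<^sub>F n in sequentially. a n > 0 \<and> a n \<ge> 2 * real K"
    using filterlim_at_top_dense[THEN iffD1, OF a] filterlim_at_top[THEN iffD1, OF a]
    by (intro eventually_conj) blast+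
  then have "\<forall>\<^sub>F n in sequentially. 1 - 4 * (2 * (d n / (a n)\<^sup>2) + inverse (a n) - 1) \<le> measure_pmf.prob (X n) {K..}"
    by eventually_elim (use bound in auto)
  then show ?thesis
    by (rule tendsto_sandwich[OF _ always_eventually lim tendsto_const]) simp
qed

subsection \<open>Factorial moments of the number of sets of given degree\<close>

lemma finite_set_pmf_random_hypergraph: "finite (set_pmf (random_hypergraph k n q))"
  by (rule finite_subset[of _ "Pow (nsets {1..n} k)"])
     (auto simp: random_hypergraph_def finite_imp_finite_nsets)

text \<open>The binomial coefficient counts the \<open>r\<close>-element families of
  \<open>j\<close>-sets all of degree \<open>s\<close>; linearity of expectation does the
  rest.\<close>

lemma expectation_choose_num_sets_of_degree:
  "measure_pmf.expectation (random_hypergraph k n q) (\<lambda>E. real (num_sets_of_degree n j s E choose r)) =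
   (\<Sum>R\<in>nsets (nsets {1..n} j) r.
      measure_pmf.prob (random_hypergraph k n q) {E. \<forall>J\<in>R. set_degree E J = s})"
proof -
  define V where "V = nsets {1..n} j"
  have fin: "finite (nsets V r)"
    unfolding V_def by (intro finite_imp_finite_nsets) auto
  have "real (num_sets_of_degree n j s E choose r) =
        (\<Sum>R\<in>nsets V r. indicator {E. \<forall>J\<in>R. set_degree E J = s} E)" for E
  proof -
    have "num_sets_of_degree n j s E choose r = card (nsets {J \<in> V. set_degree E J = s} r)"
      by (simp add: num_sets_of_degree_def V_def)
    also have "nsets {J \<in> V. set_degree E J = s} r =
               {R \<in> nsets V r. \<forall>J\<in>R. set_degree E J = s}"
      by (auto simp: nsets_def)
    also have "real (card \<dots>) = (\<Sum>R\<in>nsets V r. of_bool (\<forall>J\<in>R. set_degree E J = s))"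
      using fin by (simp add: sum.If_cases of_bool_def Int_def)
    finally show ?thesis by (simp add: indicator_def of_bool_def)
  qed
  then have "measure_pmf.expectation (random_hypergraph k n q) (\<lambda>E. real (num_sets_of_degree n j s E choose r)) =
      measure_pmf.expectation (random_hypergraph k n q)
        (\<lambda>E. \<Sum>R\<in>nsets V r. indicator {E. \<forall>J\<in>R. set_degree E J = s} E)"
    by simp
  also have "\<dots> = (\<Sum>R\<in>nsets V r. measure_pmf.expectation (random_hypergraph k n q)
                      (indicator {E. \<forall>J\<in>R. set_degree E J = s}))"
    by (rule Bochner_Integration.integral_sum)
       (rule integrable_measure_pmf_finite[OF finite_set_pmf_random_hypergraph])
  finally show ?thesis by (simp add: V_def)
qed

lemma expectation_choose_bounds:
  fixes q :: real and s n r :: nat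
  assumes q: "0 \<le> q" "q < 1" and jk: "j < k"
  defines "N \<equiv> (n - j) choose (k - j)" and "t \<equiv> r\<^sup>2 * ((n - 1) choose (k - j - 1))"
  defines "b \<equiv> pmf (binomial_pmf N q) s"
  defines "F \<equiv> measure_pmf.expectation (random_hypergraph k n q)
                  (\<lambda>E. real (num_sets_of_degree n j s E choose r))"
  shows "real ((n choose j) choose r) *
           ((1 - q) ^ t * (real ((N - t) choose s) / real (N choose s)) ^ r * b ^ r) \<le> F"
    and "real s \<le> real (N - s) * q \<Longrightarrow> F \<le> real ((n choose j) choose r) *
           ((1 + (1 - (1 - q) ^ t) * real (Suc s) ^ r) / ((1 - q) ^ t) ^ r * b ^ r)"
proof -
  let ?V = "nsets (nsets {1..n} j) r"
  have card: "real (card ?V) = real ((n choose j) choose r)" by simp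
  have F: "F = (\<Sum>R\<in>?V. measure_pmf.prob (random_hypergraph k n q) {E. \<forall>J\<in>R. set_degree E J = s})"
    unfolding F_def by (rule expectation_choose_num_sets_of_degree)
  show "real ((n choose j) choose r) *
          ((1 - q) ^ t * (real ((N - t) choose s) / real (N choose s)) ^ r * b ^ r) \<le> F"
    unfolding F card[symmetric] b_def N_def t_def
    by (intro sum_bounded_below prob_all_degree_bounds(1) q jk)
  assume "real s \<le> real (N - s) * q"
  then show "F \<le> real ((n choose j) choose r) *
          ((1 + (1 - (1 - q) ^ t) * real (Suc s) ^ r) / ((1 - q) ^ t) ^ r * b ^ r)"
    unfolding F card[symmetric] b_def N_def t_def
    by (intro sum_bounded_above prob_all_degree_bounds(2) q jk)
qed

subsection \<open>Asymptotics at the threshold\<close>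

lemma choose_over_power_tendsto:
  "(\<lambda>m. real (m choose r) / real m ^ r) \<longlonglongrightarrow> 1 / fact r"
proof (induction r)
  case (Suc r)
  \<comment> \<open>With subtraction in the reals the recursion holds for every \<open>m\<close>: if
    \<open>m < r\<close>, both coefficients vanish.\<close>
  have "real (m choose Suc r) = real (m choose r) * (real m - real r) / real (Suc r)" for m
  proof (cases "r \<le> m")
    case True
    have "Suc r * (m choose Suc r) = (m - r) * (m choose r)"
      using binomial_absorb_comp[of m r] binomial_absorption[of r m] by simp
    then have "real (Suc r) * real (m choose Suc r) = real (m - r) * real (m choose r)"
      by (metis of_nat_mult)
    then show ?thesis using True by (simp add: field_simps)
  qed (simp add: binomial_eq_0)
  then have eq: "real (m choose Suc r) / real m ^ Suc r =
      real (m choose r) / real m ^ r * ((real m - real r) / real m) / real (Suc r)" for m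
    by simp
  have "(\<lambda>m. (real m - real r) / real m) \<longlonglongrightarrow> 1"
  proof (rule Lim_transform_eventually)
    show "(\<lambda>m. 1 - real r * inverse (real m)) \<longlonglongrightarrow> 1"
      using tendsto_diff[OF tendsto_const tendsto_mult_right_zero[OF lim_inverse_n], of 1 "real r"]
      by simp
    show "\<forall>\<^sub>F m in sequentially. 1 - real r * inverse (real m) = (real m - real r) / real m"
      using eventually_gt_at_top[of 0] by eventually_elim (simp add: field_simps)
  qed
  then have "(\<lambda>m. real (m choose r) / real m ^ r * ((real m - real r) / real m) / real (Suc r))
       \<longlonglongrightarrow> 1 / fact r * 1 / real (Suc r)"
    by (intro tendsto_intros Suc) auto
  then show ?case unfolding eq by (simp add: field_simps)
qed simp

text \<open>Pascal's rule applied \<open>j\<close> times, each removed vertex costing at most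
  \<open>(n - 1) choose d\<close>. It compares the denominator of \<open>p n\<close> with the true
  number of possible edges over a \<open>j\<close>-set.\<close>

lemma choose_le_choose_diff:
  "n choose Suc d \<le> ((n - j) choose Suc d) + j * ((n - 1) choose d)"
proof (induction j)
  case (Suc j)
  have "(n - j) choose Suc d \<le> ((n - Suc j) choose Suc d) + ((n - 1) choose d)"
  proof (cases "n - j")
    case (Suc m)
    then have m: "n - Suc j = m" by simp
    have "m choose d \<le> (n - 1) choose d" using Suc by (intro binomial_right_mono) auto
    then show ?thesis by (simp add: Suc m)
  qed simp
  then show ?case using Suc by simp
qed simp

lemma eventually_pos_of_at_top:
  fixes f :: "'a \<Rightarrow> nat"
  shows "filterlim f at_top F \<Longrightarrow> \<forall>\<^sub>F x in F. f x > 0"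
  by (auto simp: filterlim_at_top Suc_le_eq dest: spec[of _ 1])

lemma choose_at_top:
  assumes "1 \<le> d"
  shows "filterlim (\<lambda>n. n choose d) at_top sequentially"
proof -
  have "filterlim (\<lambda>n. real (n choose d) / real n ^ d * real n ^ d) at_top sequentially"
    using assms
    by (intro filterlim_tendsto_pos_mult_at_top[OF choose_over_power_tendsto]
          filterlim_pow_at_top filterlim_real_sequentially) auto
  moreover have "\<forall>\<^sub>F n in sequentially. real (n choose d) / real n ^ d * real n ^ d = real (n choose d)"
    using eventually_gt_at_top[of 0] by eventually_elim simp
  ultimately have "filterlim (\<lambda>n. real (n choose d)) at_top sequentially"
    by (simp cong: filterlim_cong)
  then show ?thesis
    by (simp add: filterlim_sequentially_iff_filterlim_real)
qed

section \<open>The threshold regime: hypotheses and notation\<close>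

locale degree_threshold =
  fixes k j s :: nat and p c :: "nat \<Rightarrow> real"
  assumes j_pos: "1 \<le> j" and jk: "j < k"
    and c_small: "c \<in> o(\<lambda>n. ln (real n))"
    and p_eq: "\<And>n. p n = (real j * ln (real n) + real s * ln (ln (real n)) + c n) / real (n choose (k - j))"
begin

text \<open>The expected degree of a \<open>j\<close>-set up to o(1). The two differ because
  \<open>p n\<close> is normalised by \<open>n choose (k - j)\<close> and not by \<open>N n\<close>;
  see \<open>lam_minus_Np\<close>.\<close>

definition lam :: "nat \<Rightarrow> real" where
  "lam n = real j * ln (real n) + real s * ln (ln (real n)) + c n"

definition N :: "nat \<Rightarrow> nat" where
  "N n = (n - j) choose (k - j)"

definition b :: "nat \<Rightarrow> real" where
  "b n = pmf (binomial_pmf (N n) (p n)) s"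

definition \<mu> :: "nat \<Rightarrow> real" where
  "\<mu> n = real (n choose j) * b n"

lemma p_lam: "p n = lam n / real (n choose (k - j))"
  by (simp add: p_eq lam_def)

section \<open>Growth of \<open>lam\<close>\<close>

lemma ln_at_top': "filterlim (\<lambda>n. ln (real n)) at_top sequentially"
  by (rule filterlim_compose[OF ln_at_top filterlim_real_sequentially])

lemma lam_over_ln: "(\<lambda>n. lam n / ln (real n)) \<longlonglongrightarrow> real j"
proof (rule Lim_transform_eventually)
  have "(\<lambda>n. ln (ln (real n)) / ln (real n)) \<longlonglongrightarrow> 0"
    by (rule filterlim_compose[OF ln_x_over_x_tendsto_0 ln_at_top'])
  moreover have "(\<lambda>n. c n / ln (real n)) \<longlonglongrightarrow> 0"
    using c_small by (rule smalloD_tendsto)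
  ultimately have "(\<lambda>n. real j + real s * (ln (ln (real n)) / ln (real n)) + c n / ln (real n))
      \<longlonglongrightarrow> real j + real s * 0 + 0"
    by (intro tendsto_add tendsto_mult_left tendsto_const)
  then show "(\<lambda>n. real j + real s * (ln (ln (real n)) / ln (real n)) + c n / ln (real n)) \<longlonglongrightarrow> real j"
    by simp
  show "\<forall>\<^sub>F n in sequentially. real j + real s * (ln (ln (real n)) / ln (real n)) + c n / ln (real n)
          = lam n / ln (real n)"
    using eventually_gt_at_top[of 1] by eventually_elim (simp add: lam_def field_simps)
qed

lemma lam_at_top: "filterlim lam at_top sequentially"
proof -
  have "filterlim (\<lambda>n. lam n / ln (real n) * ln (real n)) at_top sequentially"
    using lam_over_ln j_pos ln_at_top' by (intro filterlim_tendsto_pos_mult_at_top) auto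
  moreover have "\<forall>\<^sub>F n in sequentially. lam n / ln (real n) * ln (real n) = lam n"
    using eventually_gt_at_top[of 1] by eventually_elim simp
  ultimately show ?thesis
    by (simp cong: filterlim_cong)
qed

lemma lam_pos: "\<forall>\<^sub>F n in sequentially. lam n > 0"
  using lam_at_top by (simp add: filterlim_at_top_dense)

text \<open>\<open>lam n\<close> has order \<open>ln n\<close>, which is o of the square root of
  \<open>n\<close>. The square matters because the second-order term of \<open>ln (1 - p n)\<close>,
  multiplied by \<open>N n\<close>, has size at most a constant times
  \<open>lam n * p n\<close>.\<close>

lemma lam_sq_over_n: "(\<lambda>n. (lam n)\<^sup>2 / real n) \<longlonglongrightarrow> 0"
proof (rule Lim_transform_eventually)
  have "(\<lambda>n. ln (real n) / real n powr (1/2)) \<longlonglongrightarrow> 0"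
    by (rule lim_ln_over_power) simp
  then have "(\<lambda>n. (lam n / ln (real n))\<^sup>2 * (ln (real n) / real n powr (1/2))\<^sup>2) \<longlonglongrightarrow> (real j)\<^sup>2 * 0\<^sup>2"
    by (intro tendsto_mult tendsto_power lam_over_ln)
  then show "(\<lambda>n. (lam n / ln (real n))\<^sup>2 * (ln (real n) / real n powr (1/2))\<^sup>2) \<longlonglongrightarrow> 0"
    by simp
  show "\<forall>\<^sub>F n in sequentially. (lam n / ln (real n))\<^sup>2 * (ln (real n) / real n powr (1/2))\<^sup>2
          = (lam n)\<^sup>2 / real n"
    using eventually_gt_at_top[of 1] by eventually_elim (simp add: powr_half_sqrt power_divide)
qed

lemma lam_over_n: "(\<lambda>n. lam n / real n) \<longlonglongrightarrow> 0"
proof (rule Lim_null_comparison[OF _ lam_sq_over_n])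
  have "\<forall>\<^sub>F n in sequentially. lam n \<ge> 1"
    using lam_at_top by (simp add: filterlim_at_top)
  then show "\<forall>\<^sub>F n in sequentially. norm (lam n / real n) \<le> (lam n)\<^sup>2 / real n"
    by eventually_elim (auto intro!: divide_right_mono simp: power2_eq_square)
qed

section \<open>Size of \<open>p\<close> and expected number of shared edges\<close>

lemma choose_absorb: "real n * real ((n - 1) choose (k - j - 1)) = real (k - j) * real (n choose (k - j))"
proof -
  have "Suc (k - j - 1) = k - j" using jk by simp
  then show ?thesis
    using binomial_absorption[of "k - j - 1" n] by (metis of_nat_mult)
qed

lemma p_choose: "\<forall>\<^sub>F n in sequentially.
    p n * real ((n - 1) choose (k - j - 1)) = real (k - j) * (lam n / real n)"
  using eventually_gt_at_top[of k]
proof eventually_elim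
  case (elim n)
  then have "real (n choose (k - j)) \<noteq> 0" by simp
  then show ?case
    using choose_absorb[of n] elim by (simp add: p_lam field_simps)
qed

text \<open>The binomial coefficient in \<open>p_choose\<close> is at least 1, and it equals 1 when
  \<open>k - j = 1\<close>.\<close>

lemma p_bounds: "\<forall>\<^sub>F n in sequentially. 0 < p n \<and> p n \<le> real (k - j) * (lam n / real n)"
  using p_choose lam_pos eventually_gt_at_top[of k]
proof eventually_elim
  case (elim n)
  then have "(n - 1) choose (k - j - 1) \<ge> 1" by (simp add: Suc_le_eq)
  then have "p n * 1 \<le> p n * real ((n - 1) choose (k - j - 1))"
    using elim by (intro mult_left_mono) (auto simp: p_lam)
  then show ?case using elim by (simp add: p_lam)
qed

lemma p_tendsto_0: "p \<longlonglongrightarrow> 0"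
proof (rule Lim_null_comparison)
  show "\<forall>\<^sub>F n in sequentially. norm (p n) \<le> real (k - j) * (lam n / real n)"
    using p_bounds by eventually_elim auto
  show "(\<lambda>n. real (k - j) * (lam n / real n)) \<longlonglongrightarrow> 0"
    by (rule tendsto_mult_right_zero[OF lam_over_n])
qed

lemma lam_p_tendsto_0: "(\<lambda>n. lam n * p n) \<longlonglongrightarrow> 0"
proof (rule Lim_null_comparison)
  show "\<forall>\<^sub>F n in sequentially. norm (lam n * p n) \<le> real (k - j) * ((lam n)\<^sup>2 / real n)"
    using p_bounds lam_pos
  proof eventually_elim
    case (elim n)
    then have "lam n * p n \<le> lam n * (real (k - j) * (lam n / real n))"
      by (intro mult_left_mono) auto
    then show ?case using elim by (simp add: power2_eq_square mult_ac)
  qed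
  show "(\<lambda>n. real (k - j) * ((lam n)\<^sup>2 / real n)) \<longlonglongrightarrow> 0"
    by (rule tendsto_mult_right_zero[OF lam_sq_over_n])
qed

text \<open>With \<open>r\<^sup>2\<close> in place of \<open>r\<close> this bounds the expected
  number of shared edges; with \<open>j\<close> it bounds the gap in
  \<open>Np_bounds\<close>.\<close>

lemma p_times_pairs_tendsto_0: "(\<lambda>n. p n * real (r * ((n - 1) choose (k - j - 1)))) \<longlonglongrightarrow> 0"
proof (rule Lim_transform_eventually)
  show "(\<lambda>n. real r * real (k - j) * (lam n / real n)) \<longlonglongrightarrow> 0"
    by (rule tendsto_mult_right_zero[OF lam_over_n])
  show "\<forall>\<^sub>F n in sequentially. real r * real (k - j) * (lam n / real n) =
          p n * real (r * ((n - 1) choose (k - j - 1)))"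
    using p_choose
  proof eventually_elim
    case (elim n)
    have "p n * real (r * ((n - 1) choose (k - j - 1))) =
          real r * (p n * real ((n - 1) choose (k - j - 1)))"
      by (simp only: of_nat_mult mult.left_commute)
    then show ?case by (simp only: elim mult.assoc)
  qed
qed

text \<open>\<open>lam n\<close> is \<open>p n\<close> times \<open>n choose (k - j)\<close>, and
  \<open>choose_le_choose_diff\<close> traps that coefficient between \<open>N n\<close> and
  \<open>N n\<close> plus the stated correction.\<close>

lemma Np_bounds: "\<forall>\<^sub>F n in sequentially. 0 \<le> lam n - real (N n) * p n \<and>
    lam n - real (N n) * p n \<le> p n * real (j * ((n - 1) choose (k - j - 1)))"
  using p_bounds eventually_gt_at_top[of k]
proof eventually_elim
  case (elim n)
  have Suc: "Suc (k - j - 1) = k - j" using jk by simp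
  have B: "real (n choose (k - j)) \<noteq> 0" using elim by simp
  have lam: "lam n = real (n choose (k - j)) * p n"
    using B by (simp add: p_lam)
  have "N n \<le> n choose (k - j)"
    unfolding N_def by (intro binomial_right_mono) simp
  then have 1: "real (N n) * p n \<le> real (n choose (k - j)) * p n"
    using elim by (intro mult_right_mono) auto
  have "n choose (k - j) \<le> N n + j * ((n - 1) choose (k - j - 1))"
    using choose_le_choose_diff[of n "k - j - 1" j] unfolding N_def Suc .
  then have "real (n choose (k - j)) \<le> real (N n + j * ((n - 1) choose (k - j - 1)))"
    by (rule of_nat_mono)
  then have "real (n choose (k - j)) * p n \<le> real (N n + j * ((n - 1) choose (k - j - 1))) * p n"
    using elim by (intro mult_right_mono) auto
  then show ?case using 1 unfolding lam by (simp add: algebra_simps)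
qed

lemma lam_minus_Np: "(\<lambda>n. lam n - real (N n) * p n) \<longlonglongrightarrow> 0"
proof (rule Lim_null_comparison[OF _ p_times_pairs_tendsto_0[of j]])
  show "\<forall>\<^sub>F n in sequentially. norm (lam n - real (N n) * p n) \<le> p n * real (j * ((n - 1) choose (k - j - 1)))"
    using Np_bounds by eventually_elim simp
qed

lemma Np_at_top: "filterlim (\<lambda>n. real (N n) * p n) at_top sequentially"
proof -
  have "filterlim (\<lambda>n. - (lam n - real (N n) * p n) + lam n) at_top sequentially"
    by (rule filterlim_tendsto_add_at_top[OF tendsto_minus[OF lam_minus_Np] lam_at_top])
  then show ?thesis by simp
qed

lemma N_at_top: "filterlim N at_top sequentially"
proof -
  have "\<forall>\<^sub>F n in sequentially. real (N n) * p n \<le> real (N n)"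
  proof -
    have "\<forall>\<^sub>F n in sequentially. p n < 1"
      using p_tendsto_0 by (rule order_tendstoD) simp
    then show ?thesis by eventually_elim (simp add: mult_left_le)
  qed
  then have "filterlim (\<lambda>n. real (N n)) at_top sequentially"
    by (rule filterlim_at_top_mono[OF Np_at_top])
  then show ?thesis
    by (simp add: filterlim_sequentially_iff_filterlim_real)
qed

text \<open>By Bernoulli's inequality the power lies between 1 and 1 minus a null sequence. It
  bounds from below the probability that no shared edge is present.\<close>

lemma one_minus_p_power_tendsto_1:
  "(\<lambda>n. (1 - p n) ^ (r * ((n - 1) choose (k - j - 1)))) \<longlonglongrightarrow> 1"
proof (rule tendsto_sandwich)
  let ?t = "\<lambda>n. r * ((n - 1) choose (k - j - 1))"
  have "\<forall>\<^sub>F n in sequentially. 0 \<le> p n \<and> p n \<le> 1"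
    using p_bounds order_tendstoD(2)[OF p_tendsto_0, of 1] by (auto elim: eventually_elim2)
  then show "\<forall>\<^sub>F n in sequentially. 1 - p n * real (?t n) \<le> (1 - p n) ^ ?t n"
  proof eventually_elim
    case (elim n)
    then show ?case
      using Bernoulli_inequality[of "- p n" "?t n"] by (simp add: mult_ac)
  qed
  show "\<forall>\<^sub>F n in sequentially. (1 - p n) ^ ?t n \<le> 1"
    using \<open>\<forall>\<^sub>F n in sequentially. 0 \<le> p n \<and> p n \<le> 1\<close>
    by eventually_elim (auto intro: power_le_one)
  show "(\<lambda>n. 1 - p n * real (?t n)) \<longlonglongrightarrow> 1"
    using tendsto_diff[OF tendsto_const p_times_pairs_tendsto_0[of r], of 1] by simp
qed simp

text \<open>Multiplying numerator and denominator by \<open>p n\<close> leaves a null sequence over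
  one that tends to infinity.\<close>

lemma pairs_over_N: "(\<lambda>n. real (r * ((n - 1) choose (k - j - 1))) / real (N n)) \<longlonglongrightarrow> 0"
proof (rule Lim_transform_eventually)
  let ?t = "\<lambda>n. r * ((n - 1) choose (k - j - 1))"
  show "(\<lambda>n. (p n * real (?t n)) * inverse (real (N n) * p n)) \<longlonglongrightarrow> 0"
    by (rule tendsto_mult_zero[OF p_times_pairs_tendsto_0 tendsto_inverse_0_at_top[OF Np_at_top]])
  show "\<forall>\<^sub>F n in sequentially. (p n * real (?t n)) * inverse (real (N n) * p n) = real (?t n) / real (N n)"
    using p_bounds by eventually_elim (simp add: field_simps)
qed

text \<open>Both coefficients are asymptotic to the \<open>s\<close>-th power of their upper index
  over \<open>fact s\<close>, and the quotient of the upper indices tends to 1 by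
  \<open>pairs_over_N\<close>.\<close>

lemma choose_ratio_tendsto_1:
  "(\<lambda>n. real ((N n - r * ((n - 1) choose (k - j - 1))) choose s) / real (N n choose s)) \<longlonglongrightarrow> 1"
proof -
  define t where "t = (\<lambda>n. r * ((n - 1) choose (k - j - 1)))"
  define D where "D = (\<lambda>n. N n - t n)"
  have tN: "(\<lambda>n. real (t n) / real (N n)) \<longlonglongrightarrow> 0"
    unfolding t_def by (rule pairs_over_N)
  have Npos: "\<forall>\<^sub>F n in sequentially. N n > 0"
    using N_at_top by (rule eventually_pos_of_at_top)
  have le: "\<forall>\<^sub>F n in sequentially. real (D n) = real (N n) - real (t n)"
    using order_tendstoD(2)[OF tN, of 1, simplified] Npos
    by eventually_elim (auto simp: D_def of_nat_diff)
  have DN: "(\<lambda>n. real (D n) / real (N n)) \<longlonglongrightarrow> 1"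
  proof (rule Lim_transform_eventually)
    show "(\<lambda>n. 1 - real (t n) / real (N n)) \<longlonglongrightarrow> 1"
      using tendsto_diff[OF tendsto_const tN, of 1] by simp
    show "\<forall>\<^sub>F n in sequentially. 1 - real (t n) / real (N n) = real (D n) / real (N n)"
      using le Npos by eventually_elim (simp add: diff_divide_distrib)
  qed
  have "filterlim (\<lambda>n. real (D n) / real (N n) * real (N n)) at_top sequentially"
    using DN N_at_top
    by (intro filterlim_tendsto_pos_mult_at_top filterlim_compose[OF filterlim_real_sequentially]) auto
  moreover have "\<forall>\<^sub>F n in sequentially. real (D n) / real (N n) * real (N n) = real (D n)"
    using Npos by eventually_elim simp
  ultimately have "filterlim (\<lambda>n. real (D n)) at_top sequentially"
    by (simp cong: filterlim_cong)
  then have D: "filterlim D at_top sequentially"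
    by (simp add: filterlim_sequentially_iff_filterlim_real)
  have Dpos: "\<forall>\<^sub>F n in sequentially. D n > 0"
    using D by (rule eventually_pos_of_at_top)
  have "(\<lambda>n. (real (D n choose s) / real (D n) ^ s) / (real (N n choose s) / real (N n) ^ s) *
            (real (D n) / real (N n)) ^ s) \<longlonglongrightarrow> (1 / fact s) / (1 / fact s) * 1 ^ s"
    by (intro tendsto_mult tendsto_divide tendsto_power DN
         filterlim_compose[OF choose_over_power_tendsto D]
         filterlim_compose[OF choose_over_power_tendsto N_at_top]) simp
  then have "(\<lambda>n. (real (D n choose s) / real (D n) ^ s) / (real (N n choose s) / real (N n) ^ s) *
            (real (D n) / real (N n)) ^ s) \<longlonglongrightarrow> 1" by simp
  then have "(\<lambda>n. real (D n choose s) / real (N n choose s)) \<longlonglongrightarrow> 1"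
  proof (rule Lim_transform_eventually)
    show "\<forall>\<^sub>F n in sequentially. (real (D n choose s) / real (D n) ^ s) / (real (N n choose s) / real (N n) ^ s) *
            (real (D n) / real (N n)) ^ s = real (D n choose s) / real (N n choose s)"
      using Npos Dpos by eventually_elim (simp add: power_divide)
  qed
  then show ?thesis by (simp only: D_def t_def)
qed

section \<open>Factorial moments relative to powers of the mean\<close>

lemma b_pos: "\<forall>\<^sub>F n in sequentially. b n > 0"
proof -
  have "\<forall>\<^sub>F n in sequentially. N n \<ge> s"
    using N_at_top by (simp add: filterlim_at_top)
  then show ?thesis
    using p_bounds order_tendstoD(2)[OF p_tendsto_0, of 1, simplified]
    by eventually_elim (auto simp: b_def)
qed

text \<open>Dividing the bounds of \<open>expectation_choose_bounds\<close> by
  \<open>\<mu> n ^ r\<close> cancels the power of \<open>b n\<close>, leaving \<open>C n\<close>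
  times correction factors \<open>L n\<close> and \<open>U n\<close> that tend to 1. Nothing is
  assumed about a limit of \<open>c\<close>, so all three regimes can use it.\<close>

lemma moment_ratio_tendsto:
  "(\<lambda>n. measure_pmf.expectation (random_hypergraph k n (p n))
          (\<lambda>E. real (num_sets_of_degree n j s E choose r)) / \<mu> n ^ r) \<longlonglongrightarrow> 1 / fact r"
proof -
  define t where "t = (\<lambda>n. r\<^sup>2 * ((n - 1) choose (k - j - 1)))"
  define F where "F = (\<lambda>n. measure_pmf.expectation (random_hypergraph k n (p n))
          (\<lambda>E. real (num_sets_of_degree n j s E choose r)))"
  define M where "M = (\<lambda>n. n choose j)"
  define C where "C = (\<lambda>n. real (M n choose r) / real (M n) ^ r)"
  define L where "L = (\<lambda>n. (1 - p n) ^ t n * (real ((N n - t n) choose s) / real (N n choose s)) ^ r)"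
  define U where "U = (\<lambda>n. (1 + (1 - (1 - p n) ^ t n) * real (Suc s) ^ r) / ((1 - p n) ^ t n) ^ r)"
  have pt: "(\<lambda>n. (1 - p n) ^ t n) \<longlonglongrightarrow> 1"
    unfolding t_def by (rule one_minus_p_power_tendsto_1)
  have "L \<longlonglongrightarrow> 1 * 1 ^ r"
    unfolding L_def by (intro tendsto_mult pt tendsto_power) (unfold t_def, rule choose_ratio_tendsto_1)
  then have L: "L \<longlonglongrightarrow> 1" by simp
  have "U \<longlonglongrightarrow> (1 + (1 - 1) * real (Suc s) ^ r) / 1 ^ r"
    unfolding U_def
    by (intro tendsto_divide tendsto_add tendsto_mult tendsto_diff tendsto_const pt tendsto_power) simp
  then have U: "U \<longlonglongrightarrow> 1" by simp
  have M: "filterlim M at_top sequentially"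
    unfolding M_def by (rule choose_at_top[OF j_pos])
  have C: "C \<longlonglongrightarrow> 1 / fact r"
    unfolding C_def by (rule filterlim_compose[OF choose_over_power_tendsto M])
  have "\<forall>\<^sub>F n in sequentially. M n > 0"
    using M by (rule eventually_pos_of_at_top)
  then have \<mu>: "\<forall>\<^sub>F n in sequentially. \<mu> n > 0 \<and> M n > 0"
    using b_pos by eventually_elim (simp add: \<mu>_def M_def)
  have "\<forall>\<^sub>F n in sequentially. 0 \<le> p n \<and> p n < 1"
    using p_bounds order_tendstoD(2)[OF p_tendsto_0, of 1, simplified] by eventually_elim auto
  moreover have "\<forall>\<^sub>F n in sequentially. real s \<le> real (N n - s) * p n"
  proof -
    \<comment> \<open>Twice \<open>s\<close> suffices: as \<open>p n < 1\<close>, passing from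
      \<open>N n\<close> to \<open>N n - s\<close> loses at most \<open>s\<close> from the
      product.\<close>
    have "\<forall>\<^sub>F n in sequentially. real (N n) * p n \<ge> 2 * real s"
      using Np_at_top by (simp add: filterlim_at_top)
    moreover have "\<forall>\<^sub>F n in sequentially. N n \<ge> s"
      using N_at_top by (simp add: filterlim_at_top)
    ultimately show ?thesis
      using p_bounds order_tendstoD(2)[OF p_tendsto_0, of 1, simplified]
    proof eventually_elim
      case (elim n)
      then have "real s * p n \<le> real s * 1" by (intro mult_left_mono) auto
      then show ?case using elim by (simp add: of_nat_diff algebra_simps)
    qed
  qed
  ultimately have bounds: "\<forall>\<^sub>F n in sequentially. C n * L n \<le> F n / \<mu> n ^ r \<and> F n / \<mu> n ^ r \<le> C n * U n"
    using \<mu>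
  proof eventually_elim
    case (elim n)
    have "real (M n choose r) * (L n * b n ^ r) \<le> F n" "F n \<le> real (M n choose r) * (U n * b n ^ r)"
      unfolding L_def F_def b_def M_def U_def N_def t_def
      by (rule expectation_choose_bounds; use elim jk in \<open>simp add: N_def del: of_nat_diff\<close>)+
    moreover have "\<mu> n ^ r = real (M n) ^ r * b n ^ r" by (simp add: \<mu>_def M_def power_mult_distrib)
    moreover have "b n > 0"
      using elim by (simp add: \<mu>_def M_def zero_less_mult_iff)
    ultimately show ?case
      using elim by (simp add: C_def field_simps)
  qed
  have "(\<lambda>n. F n / \<mu> n ^ r) \<longlonglongrightarrow> 1 / fact r"
  proof (rule tendsto_sandwich)
    show "\<forall>\<^sub>F n in sequentially. C n * L n \<le> F n / \<mu> n ^ r"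
      using bounds by eventually_elim simp
    show "\<forall>\<^sub>F n in sequentially. F n / \<mu> n ^ r \<le> C n * U n"
      using bounds by eventually_elim simp
    show "(\<lambda>n. C n * L n) \<longlonglongrightarrow> 1 / fact r" using tendsto_mult[OF C L] by simp
    show "(\<lambda>n. C n * U n) \<longlonglongrightarrow> 1 / fact r" using tendsto_mult[OF C U] by simp
  qed
  then show ?thesis by (simp only: F_def)
qed

text \<open>\<open>N ln (1 - p) = - N p + O(N p\<^sup>2)\<close>, where \<open>N p\<close> is
  \<open>lam\<close> up to o(1) and \<open>N p\<^sup>2 \<le> lam p\<close> tends to 0. The missing
  \<open>s\<close> factors tend to 1.\<close>

lemma one_minus_p_power_N: "(\<lambda>n. (1 - p n) ^ (N n - s) * exp (lam n)) \<longlonglongrightarrow> 1"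
proof (rule Lim_transform_eventually)
  have "(\<lambda>n. real (N n) * (ln (1 - p n) + p n)) \<longlonglongrightarrow> 0"
  proof (rule Lim_null_comparison)
    show "(\<lambda>n. 2 * (lam n * p n)) \<longlonglongrightarrow> 0"
      by (rule tendsto_mult_right_zero[OF lam_p_tendsto_0])
    show "\<forall>\<^sub>F n in sequentially. norm (real (N n) * (ln (1 - p n) + p n)) \<le> 2 * (lam n * p n)"
      using p_bounds Np_bounds order_tendstoD(2)[OF p_tendsto_0, of "1/2", simplified]
    proof eventually_elim
      case (elim n)
      have "\<bar>ln (1 - p n) + p n\<bar> \<le> 2 * (p n)\<^sup>2"
        using abs_ln_one_plus_x_minus_x_bound_nonpos[of "- p n"] elim by simp
      then have "norm (real (N n) * (ln (1 - p n) + p n)) \<le> real (N n) * (2 * (p n)\<^sup>2)"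
        by (simp add: abs_mult mult_left_mono)
      also have "\<dots> = 2 * ((real (N n) * p n) * p n)"
        by (simp add: power2_eq_square)
      also have "\<dots> \<le> 2 * (lam n * p n)"
        using elim by (intro mult_left_mono mult_right_mono) auto
      finally show ?case .
    qed
  qed
  then have "(\<lambda>n. exp ((lam n - real (N n) * p n) + real (N n) * (ln (1 - p n) + p n)) / (1 - p n) ^ s)
       \<longlonglongrightarrow> exp (0 + 0) / (1 - 0) ^ s"
    by (intro tendsto_divide tendsto_exp tendsto_add lam_minus_Np tendsto_power tendsto_diff
         tendsto_const p_tendsto_0) auto
  then show "(\<lambda>n. exp ((lam n - real (N n) * p n) + real (N n) * (ln (1 - p n) + p n)) / (1 - p n) ^ s) \<longlonglongrightarrow> 1"
    by simp
  have "\<forall>\<^sub>F n in sequentially. N n \<ge> s"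
    using N_at_top by (simp add: filterlim_at_top)
  then show "\<forall>\<^sub>F n in sequentially. exp ((lam n - real (N n) * p n) + real (N n) * (ln (1 - p n) + p n)) / (1 - p n) ^ s
         = (1 - p n) ^ (N n - s) * exp (lam n)"
    using p_bounds order_tendstoD(2)[OF p_tendsto_0, of 1, simplified]
  proof eventually_elim
    case (elim n)
    have "(lam n - real (N n) * p n) + real (N n) * (ln (1 - p n) + p n) = lam n + real (N n) * ln (1 - p n)"
      by (simp add: algebra_simps)
    moreover have "exp (lam n + real (N n) * ln (1 - p n)) = exp (lam n) * (1 - p n) ^ N n"
      using elim by (simp add: exp_add exp_of_nat_mult)
    ultimately have "exp ((lam n - real (N n) * p n) + real (N n) * (ln (1 - p n) + p n)) =
                     exp (lam n) * (1 - p n) ^ N n"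
      by (simp only:)
    then show ?case
      using elim by (simp add: power_diff)
  qed
qed

text \<open>Here \<open>exp (lam n)\<close> is \<open>n ^ j * ln n ^ s * exp (c n)\<close>. The
  power of \<open>n\<close> normalises the number of \<open>j\<close>-sets, and the power of
  \<open>ln n\<close>, coming from the iterated logarithm in \<open>p n\<close>, normalises
  \<open>(N n * p n) ^ s\<close>. The four factors tend to \<open>1 / fact j\<close>,
  \<open>1 / fact s\<close>, \<open>j ^ s\<close> and 1.\<close>

lemma mean_asymptotics: "(\<lambda>n. \<mu> n * exp (c n)) \<longlonglongrightarrow> real j ^ s / (fact j * fact s)"
proof (rule Lim_transform_eventually)
  have Npln: "(\<lambda>n. real (N n) * p n / ln (real n)) \<longlonglongrightarrow> real j"
  proof -
    have "(\<lambda>n. lam n / ln (real n) - (lam n - real (N n) * p n) * inverse (ln (real n))) \<longlonglongrightarrow> real j - 0"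
      by (intro tendsto_diff lam_over_ln
            tendsto_mult_zero[OF lam_minus_Np tendsto_inverse_0_at_top[OF ln_at_top']])
    then show ?thesis by (simp add: diff_divide_distrib divide_inverse[symmetric])
  qed
  show "(\<lambda>n. real (n choose j) / real n ^ j * (real (N n choose s) / real (N n) ^ s *
           (real (N n) * p n / ln (real n)) ^ s * ((1 - p n) ^ (N n - s) * exp (lam n))))
        \<longlonglongrightarrow> real j ^ s / (fact j * fact s)"
    using tendsto_mult[OF choose_over_power_tendsto[of j]
        tendsto_mult[OF tendsto_mult[OF filterlim_compose[OF choose_over_power_tendsto N_at_top, of s]
          tendsto_power[OF Npln, of s]] one_minus_p_power_N]]
    by simp
  have "\<forall>\<^sub>F n in sequentially. N n > 0"
    using N_at_top by (rule eventually_pos_of_at_top)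
  then show "\<forall>\<^sub>F n in sequentially. real (n choose j) / real n ^ j * (real (N n choose s) / real (N n) ^ s *
           (real (N n) * p n / ln (real n)) ^ s * ((1 - p n) ^ (N n - s) * exp (lam n))) = \<mu> n * exp (c n)"
    using p_bounds order_tendstoD(2)[OF p_tendsto_0, of 1, simplified] eventually_gt_at_top[of 1]
  proof eventually_elim
    case (elim n)
    have "exp (lam n) = real n ^ j * ln (real n) ^ s * exp (c n)"
      using elim by (simp add: lam_def exp_add exp_of_nat_mult)
    moreover have "b n = real (N n choose s) * p n ^ s * (1 - p n) ^ (N n - s)"
      using elim by (simp add: b_def)
    ultimately show ?case
      using elim by (simp add: \<mu>_def power_divide power_mult_distrib)
  qed
qed

end

section \<open>The three regimes\<close>

theorem theorem7:
  fixes k j s :: nat and p c :: "nat \<Rightarrow> real"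
  assumes "k \<ge> 2" and "1 \<le> j" and "j \<le> k - 1"
    and "c \<in> o(\<lambda>n. ln (real n))"
    and "\<And>n. p n = (real j * ln (real n) + real s * ln (ln (real n)) + c n) / real (n choose (k - j))"
  shows "(filterlim c at_top sequentially \<longrightarrow>
            (\<lambda>n. measure_pmf.prob (random_hypergraph k n (p n))
                   {E. num_sets_of_degree n j s E = 0}) \<longlonglongrightarrow> 1)
       \<and> (\<forall>c\<^sub>0::real. c \<longlonglongrightarrow> c\<^sub>0 \<longrightarrow>
            converges_in_distribution
              (\<lambda>n. map_pmf (\<lambda>E. int (num_sets_of_degree n j s E)) (random_hypergraph k n (p n)))
              (map_pmf int (poisson_pmf (real j ^ s * exp (- c\<^sub>0) / (fact j * fact s)))))
       \<and> (filterlim c at_bot sequentially \<longrightarrow>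
            (\<forall>K::nat. (\<lambda>n. measure_pmf.prob (random_hypergraph k n (p n))
                   {E. num_sets_of_degree n j s E \<ge> K}) \<longlonglongrightarrow> 1))"
proof -
  interpret degree_threshold k j s p c
    by unfold_locales (use assms in auto)
  define X where "X = (\<lambda>n. map_pmf (num_sets_of_degree n j s) (random_hypergraph k n (p n)))"
  define F where "F = (\<lambda>r n. measure_pmf.expectation (X n) (\<lambda>x. real (x choose r)))"
  have fin: "finite (set_pmf (X n))" for n
    by (simp add: X_def finite_set_pmf_random_hypergraph)
  have ratio: "(\<lambda>n. F r n / \<mu> n ^ r) \<longlonglongrightarrow> 1 / fact r" for r
    using moment_ratio_tendsto[of r] by (simp add: F_def X_def)
  have mean: "F 1 n = measure_pmf.expectation (X n) real" for n
    by (simp add: F_def)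
  have \<mu>_pos: "\<forall>\<^sub>F n in sequentially. \<mu> n > 0"
    using b_pos eventually_pos_of_at_top[OF choose_at_top[OF j_pos]]
    by eventually_elim (simp add: \<mu>_def)
  have moment_lim: "F r \<longlonglongrightarrow> m ^ r / fact r" if "\<mu> \<longlonglongrightarrow> m" for r m
  proof (rule Lim_transform_eventually)
    show "(\<lambda>n. F r n / \<mu> n ^ r * \<mu> n ^ r) \<longlonglongrightarrow> m ^ r / fact r"
      using tendsto_mult[OF ratio[of r] tendsto_power[OF that, of r]] by simp
    show "\<forall>\<^sub>F n in sequentially. F r n / \<mu> n ^ r * \<mu> n ^ r = F r n"
      using \<mu>_pos by eventually_elim simp
  qed
  \<comment> \<open>The first product converges to a positive constant, so
    \<open>exp (- c n)\<close> alone decides whether the mean vanishes, converges or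
    diverges.\<close>
  have \<mu>_exp: "\<mu> n = \<mu> n * exp (c n) * exp (- c n)" for n
    by (simp add: exp_minus)
  have zero: "(\<lambda>n. measure_pmf.prob (random_hypergraph k n (p n)) {E. num_sets_of_degree n j s E = 0}) \<longlonglongrightarrow> 1"
    if c: "filterlim c at_top sequentially"
  proof -
    have "(\<lambda>n. exp (- c n)) \<longlonglongrightarrow> 0"
      using c by (intro filterlim_compose[OF exp_at_bot] filterlim_uminus_at_top[THEN iffD1])
    from tendsto_mult[OF mean_asymptotics this] have "\<mu> \<longlonglongrightarrow> 0"
      unfolding \<mu>_exp[symmetric] by simp
    then have "F 1 \<longlonglongrightarrow> 0" using moment_lim[of 0 1] by simp
    then have "(\<lambda>n. measure_pmf.prob (X n) {0}) \<longlonglongrightarrow> 1"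
      unfolding mean by (rule prob_zero_tendsto_1[OF fin])
    then show ?thesis by (simp add: X_def measure_map_pmf vimage_def)
  qed
  have poisson: "converges_in_distribution
        (\<lambda>n. map_pmf (\<lambda>E. int (num_sets_of_degree n j s E)) (random_hypergraph k n (p n)))
        (map_pmf int (poisson_pmf (real j ^ s * exp (- c\<^sub>0) / (fact j * fact s))))"
    if c: "c \<longlonglongrightarrow> c\<^sub>0" for c\<^sub>0
  proof -
    define m where "m = real j ^ s * exp (- c\<^sub>0) / (fact j * fact s)"
    have "m > 0" using j_pos by (simp add: m_def)
    have "\<mu> \<longlonglongrightarrow> m"
      using tendsto_mult[OF mean_asymptotics tendsto_exp[OF tendsto_minus[OF c]]]
      unfolding \<mu>_exp[symmetric] by (simp add: m_def)
    then have lim: "(\<lambda>n. pmf (X n) i) \<longlonglongrightarrow> pmf (poisson_pmf m) i" for i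
      using pmf_tendsto_poisson[OF fin moment_lim[unfolded F_def]] \<open>m > 0\<close> by simp
    have X: "map_pmf (\<lambda>E. int (num_sets_of_degree n j s E)) (random_hypergraph k n (p n)) = map_pmf int (X n)" for n
      by (simp add: X_def map_pmf_comp)
    \<comment> \<open>Injectivity of \<open>int\<close> transfers the limit to nonnegative integers;
      negative ones have mass 0 on both sides.\<close>
    have "(\<lambda>n. pmf (map_pmf int (X n)) i) \<longlonglongrightarrow> pmf (map_pmf int (poisson_pmf m)) i" for i
    proof (cases "i \<ge> 0")
      case True
      then obtain l where "i = int l" using nonneg_int_cases by blast
      then show ?thesis using lim[of l] by (simp add: pmf_map_inj')
    next
      case False
      then have "pmf (map_pmf int Y) i = 0" for Y
        by (intro pmf_map_outside) auto
      then show ?thesis by simp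
    qed
    then show ?thesis
      unfolding converges_in_distribution_def X m_def[symmetric] by blast
  qed
  have infinite: "(\<lambda>n. measure_pmf.prob (random_hypergraph k n (p n)) {E. num_sets_of_degree n j s E \<ge> K}) \<longlonglongrightarrow> 1"
    if c: "filterlim c at_bot sequentially" for K
  proof -
    have "filterlim (\<lambda>n. exp (- c n)) at_top sequentially"
      using c by (intro filterlim_compose[OF exp_at_top] filterlim_uminus_at_bot[THEN iffD1])
    then have "filterlim (\<lambda>n. \<mu> n * exp (c n) * exp (- c n)) at_top sequentially"
      using j_pos by (intro filterlim_tendsto_pos_mult_at_top[OF mean_asymptotics]) auto
    then have \<mu>_top: "filterlim \<mu> at_top sequentially"
      unfolding \<mu>_exp[symmetric] .
    have ratio1: "(\<lambda>n. F 1 n / \<mu> n) \<longlonglongrightarrow> 1"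
      using ratio[of 1] by simp
    have "filterlim (\<lambda>n. F 1 n / \<mu> n * \<mu> n) at_top sequentially"
      by (rule filterlim_tendsto_pos_mult_at_top[OF ratio1 _ \<mu>_top]) simp
    moreover have "\<forall>\<^sub>F n in sequentially. F 1 n / \<mu> n * \<mu> n \<le> F 1 n"
      using \<mu>_pos by eventually_elim simp
    ultimately have m1: "filterlim (F 1) at_top sequentially"
      by (rule filterlim_at_top_mono)
    \<comment> \<open>Normalising both moments by \<open>\<mu> n ^ 2\<close> turns the quotient into
      one of convergent sequences, with limit \<open>(1 / fact 2) / 1\<close>.\<close>
    have m2: "(\<lambda>n. F 2 n / (F 1 n)\<^sup>2) \<longlonglongrightarrow> 1 / 2"
    proof (rule Lim_transform_eventually)
      show "(\<lambda>n. (F 2 n / \<mu> n ^ 2) / (F 1 n / \<mu> n)\<^sup>2) \<longlonglongrightarrow> 1 / 2"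
        using tendsto_divide[OF ratio[of 2] tendsto_power[OF ratio1, of 2]] by (simp add: fact_2)
      show "\<forall>\<^sub>F n in sequentially. (F 2 n / \<mu> n ^ 2) / (F 1 n / \<mu> n)\<^sup>2 = F 2 n / (F 1 n)\<^sup>2"
        using \<mu>_pos by eventually_elim (simp add: power_divide)
    qed
    have "(\<lambda>n. measure_pmf.prob (X n) {K..}) \<longlonglongrightarrow> 1"
      by (rule second_moment_prob_ge_tendsto_1[OF fin])
         (use m1 m2 in \<open>simp_all only: F_def choose_one\<close>)
    then show ?thesis by (simp add: X_def measure_map_pmf vimage_def)
  qed
  show ?thesis using zero poisson infinite by blast
qed

end
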